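(* Let $\lambda$ be a partition with $d=\ell(\lambda)$ parts and $\mu$ a partition with $[\mu]\subseteq[\lambda]$. Then $$f^{\lambda/\mu}=\frac{|\lambda/\mu|!}{\prod_{u\in[\lambda]}h(u)}\sum_{\mathsf t\in L(\nabla_{\lambda/\mu})}\ \prod_{r\in R_\leftarrow(\mathsf t)}w(r).$$
   Context: $f^{\lambda/\mu}$ is the number of standard Young tableaux of shape $\lambda/\mu$; $h(u)$ is the hook length of $u$ in $\lambda$; $\mu_i=0$ for $i>\ell(\mu)$. Work in the triangular lattice of unit equilateral triangles, each having a horizontal edge; the other edge directions point NE (at $60^\circ$ from horizontal) and NW (at $120^\circ$). The region $\nabla_{\lambda/\mu}$: it has $d$ horizontal rows of unit triangles, together with $d$ unit triangles (peaks) above the top row. Its left boundary goes from the bottom-left corner in the NW direction for $d$ unit steps. Starting again at the bottom-left corner, the lower-right boundary consists of $\lambda_d$ unit steps to the right, one step NE, $\lambda_{d-1}-\lambda_d$ steps right, one step NE, and so on, ending with $\lambda_1-\lambda_2$ steps right and one step NE, reaching the top-right corner. The top boundary, from the top-left corner to the top-right corner, consists of $\mu_d$ unit steps right, a peak, $\mu_{d-1}-\mu_d$ steps right, a peak, $\dots$, $\mu_1-\mu_2$ steps right, a peak, and finally $\lambda_1-\mu_1$ steps right, where a peak is one step NE followed by one step SE (so it adjoins to the region an upward unit triangle whose base lies on the top line). A lozenge is a union of two adjacent unit triangles; $L(R)$ is the set of tilings of $R$ by lozenges. A lozenge is called NW-SE if its longer diagonal runs in the NW-SE direction (equivalently, its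 sides are horizontal and parallel to the NW direction). $R_\leftarrow(\mathsf t)$ is the set of NW-SE lozenges in $\mathsf t$, and for $r\in R_\leftarrow(\mathsf t)$, $w(r)$ is the distance from the center of $r$ to the rightmost point of $\nabla_{\lambda/\mu}$ at the same height (an integer). *)

theory Defs
  imports "HOL-Analysis.Analysis"
begin

section \<open>Partitions, skew shapes and standard Young tableaux\<close>

definition is_partition :: "nat list \<Rightarrow> bool" where
  "is_partition lam \<longleftrightarrow> sorted_wrt (\<ge>) lam \<and> 0 \<notin> set lam"

text \<open>Parts are numbered from 1, and parts beyond the length are 0.\<close>

definition nth_part :: "nat list \<Rightarrow> nat \<Rightarrow> nat" where
  "nth_part lam i = (if 1 \<le> i \<and> i \<le> length lam then lam ! (i - 1) else 0)"

definition diagram :: "nat list \<Rightarrow> (nat \<times> nat) set" where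
  "diagram lam = {(i, j). 1 \<le> i \<and> i \<le> length lam \<and> 1 \<le> j \<and> j \<le> nth_part lam i}"

definition skew :: "nat list \<Rightarrow> nat list \<Rightarrow> (nat \<times> nat) set" where
  "skew lam mu = diagram lam - diagram mu"

text \<open>Functions in \<open>SYT\<close> are made extensional (value \<open>undefined\<close> outside the shape),
  so that distinct elements are distinct tableaux.\<close>

definition SYT :: "nat list \<Rightarrow> nat list \<Rightarrow> (nat \<times> nat \<Rightarrow> nat) set" where
  "SYT lam mu = {T \<in> extensional (skew lam mu).
     bij_betw T (skew lam mu) {1..card (skew lam mu)} \<and>
     (\<forall>i j j'. (i, j) \<in> skew lam mu \<and> (i, j') \<in> skew lam mu \<and> j < j' \<longrightarrow> T (i, j) < T (i, j')) \<and>
     (\<forall>i i' j. (i, j) \<in> skew lam mu \<and> (i', j) \<in> skew lam mu \<and> i < i' \<longrightarrow> T (i, j) < T (i', j))}"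

definition hook :: "nat list \<Rightarrow> nat \<times> nat \<Rightarrow> (nat \<times> nat) set" where
  "hook lam u = {v \<in> diagram lam.
     (fst v = fst u \<and> snd u \<le> snd v) \<or> (snd v = snd u \<and> fst u \<le> fst v)}"

definition hook_length :: "nat list \<Rightarrow> nat \<times> nat \<Rightarrow> nat" where
  "hook_length lam u = card (hook lam u)"


section \<open>The triangular lattice\<close>

text \<open>The pair \<open>(a, b)\<close> stands for the lattice point reached from the origin by \<open>a\<close> unit steps
  to the right and \<open>b\<close> unit steps NE; \<open>plane_point\<close> gives its position in the Euclidean plane.\<close>

type_synonym point = "int \<times> int"

definition plane_point :: "point \<Rightarrow> complex" where
  "plane_point p = of_int (fst p) + of_int (snd p) * cis (pi / 3)"

abbreviation E :: point where "E \<equiv> (1, 0)"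
abbreviation NE :: point where "NE \<equiv> (0, 1)"
abbreviation NW :: point where "NW \<equiv> (- 1, 1)"
abbreviation SE :: point where "SE \<equiv> (1, - 1)"

text \<open>\<open>Up p\<close> has \<open>p\<close> as its lower left vertex, \<open>Down p\<close> has \<open>p\<close> as its lowest vertex.\<close>

datatype triangle = Up point | Down point

fun verts :: "triangle \<Rightarrow> point set" where
  "verts (Up p) = {p, p + E, p + NE}"
| "verts (Down p) = {p, p + NE, p + NW}"

text \<open>Regions are sets of unit triangles; a lozenge is the set of its two triangles.\<close>

definition lozenge :: "triangle set \<Rightarrow> bool" where
  "lozenge r \<longleftrightarrow> (\<exists>s t. r = {s, t} \<and> s \<noteq> t \<and> card (verts s \<inter> verts t) = 2)"

definition tilings :: "triangle set \<Rightarrow> triangle set set set" where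
  "tilings R = {T. partition_on R T \<and> (\<forall>r\<in>T. lozenge r)}"

definition lozenge_verts :: "triangle set \<Rightarrow> point set" where
  "lozenge_verts r = \<Union> (verts ` r)"

text \<open>The longer diagonal of a lozenge with sides in the directions \<open>- E\<close> and \<open>NW\<close> is their
  sum \<open>(- 2, 1)\<close>. No two vertices of a lozenge of another type differ by this vector.\<close>

definition nw_se :: "triangle set \<Rightarrow> bool" where
  "nw_se r \<longleftrightarrow> lozenge r \<and>
     (\<exists>p. p \<in> lozenge_verts r \<and> p + (- E + NW) \<in> lozenge_verts r)"

definition center :: "triangle set \<Rightarrow> complex" where
  "center r = (\<Sum>p\<in>lozenge_verts r. plane_point p) / 4"


section \<open>The region\<close>

text \<open>Row \<open>j\<close> lies between the horizontal lines at lattice heights \<open>j\<close> and \<open>j + 1\<close>, the left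
  boundary (points \<open>(- y, y)\<close>), and the \<open>NE\<close> step of the lower right boundary from
  \<open>(\<lambda>\<^bsub>d-j\<^esub>, j)\<close>. The peak for \<open>\<mu>\<^sub>i\<close> is preceded on the top line by \<open>\<mu>\<^sub>i\<close> right steps and the
  bases of \<open>d - i\<close> other peaks. Lemma \<open>boundary_nabla\<close> below checks that this is the region
  whose boundary is the lattice path described by \<open>left_steps\<close>, \<open>lower_right_steps\<close>
  and \<open>top_steps\<close>.\<close>

definition region_row :: "nat list \<Rightarrow> nat \<Rightarrow> triangle set" where
  "region_row lam j = {t. \<forall>(x, y) \<in> verts t. int j \<le> y \<and> y \<le> int j + 1 \<and>
      - y \<le> x \<and> x \<le> int (nth_part lam (length lam - j))}"

definition peaks :: "nat list \<Rightarrow> nat list \<Rightarrow> triangle set" where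
  "peaks lam mu = (\<lambda>i. Up (int (nth_part mu i) - int i, int (length lam))) ` {1..length lam}"

definition nabla :: "nat list \<Rightarrow> nat list \<Rightarrow> triangle set" where
  "nabla lam mu = (\<Union>j<length lam. region_row lam j) \<union> peaks lam mu"

definition plane_region :: "triangle set \<Rightarrow> complex set" where
  "plane_region R = (\<Union>t\<in>R. convex hull (plane_point ` verts t))"

definition rightmost :: "complex set \<Rightarrow> real \<Rightarrow> complex" where
  "rightmost S h = Complex (Sup (Re ` {z \<in> S. Im z = h})) h"

definition weight :: "nat list \<Rightarrow> nat list \<Rightarrow> triangle set \<Rightarrow> real" where
  "weight lam mu r =
     dist (center r) (rightmost (plane_region (nabla lam mu)) (Im (center r)))"


subsection \<open>The boundary of the region\<close>

fun walk_edges :: "point \<Rightarrow> point list \<Rightarrow> point set set" where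
  "walk_edges p [] = {}"
| "walk_edges p (s # ss) = insert {p, p + s} (walk_edges (p + s) ss)"

definition boundary :: "triangle set \<Rightarrow> point set set" where
  "boundary R = {e. card e = 2 \<and> (\<exists>!t. t \<in> R \<and> e \<subseteq> verts t)}"

definition left_steps :: "nat list \<Rightarrow> point list" where
  "left_steps lam = replicate (length lam) NW"

text \<open>As \<open>\<lambda>\<^bsub>d+1\<^esub> = \<mu>\<^bsub>d+1\<^esub> = 0\<close>, the first runs are of lengths \<open>\<lambda>\<^sub>d\<close> and \<open>\<mu>\<^sub>d\<close>.\<close>

definition lower_right_steps :: "nat list \<Rightarrow> point list" where
  "lower_right_steps lam =
     concat (map (\<lambda>i. replicate (nth_part lam i - nth_part lam (Suc i)) E @ [NE])
       (rev [1..<Suc (length lam)]))"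

definition top_steps :: "nat list \<Rightarrow> nat list \<Rightarrow> point list" where
  "top_steps lam mu =
     concat (map (\<lambda>i. replicate (nth_part mu i - nth_part mu (Suc i)) E @ [NE, SE])
       (rev [1..<Suc (length lam)])) @
     replicate (nth_part lam 1 - nth_part mu 1) E"

lemma nth_part_antimono:
  assumes "is_partition lam" "1 \<le> i" "i \<le> j"
  shows "nth_part lam j \<le> nth_part lam i"
proof (cases "i = j \<or> j > length lam")
  case True
  then show ?thesis by (auto simp: nth_part_def)
next
  case False
  then have "i - 1 < j - 1" "j - 1 < length lam" "j \<le> length lam" using assms by auto
  then show ?thesis
    using assms sorted_wrt_nth_less[of "(\<ge>)" lam "i - 1" "j - 1"]
    by (auto simp: nth_part_def is_partition_def)
qed

lemma nth_part_mono_diagram: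
  assumes "is_partition mu" "diagram mu \<subseteq> diagram lam" "1 \<le> i"
  shows "nth_part mu i \<le> nth_part lam i"
proof (cases "nth_part mu i = 0")
  case False
  then have "(i, nth_part mu i) \<in> diagram mu"
    using assms(3) by (auto simp: diagram_def nth_part_def split: if_splits)
  then have "(i, nth_part mu i) \<in> diagram lam" using assms(2) by blast
  then show ?thesis by (auto simp: diagram_def)
qed simp

lemma walk_edges_append:
  "walk_edges p (xs @ ys) = walk_edges p xs \<union> walk_edges (p + sum_list xs) ys"
  by (induction p xs rule: walk_edges.induct) (auto simp: add.assoc)

definition hedge :: "int \<Rightarrow> int \<Rightarrow> point set" where "hedge a b = {(a, b), (a + 1, b)}"
definition nedge :: "int \<Rightarrow> int \<Rightarrow> point set" where "nedge a b = {(a, b), (a, b + 1)}"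
definition wedge :: "int \<Rightarrow> int \<Rightarrow> point set" where "wedge a b = {(a, b), (a - 1, b + 1)}"

lemmas edge_defs = hedge_def nedge_def wedge_def

lemma sum_list_replicate_point:
  "sum_list (replicate n (x :: int, y :: int)) = (int n * x, int n * y)"
  by (induction n) (auto simp: algebra_simps zero_prod_def)

lemma walk_edges_E:
  "walk_edges (x, y) (replicate n E) = {hedge a y | a. x \<le> a \<and> a < x + int n}"
proof (induction n)
  case (Suc n)
  have r: "replicate (Suc n) E = replicate n E @ [E]"
    by (simp add: replicate_append_same)
  have "x \<le> a \<and> a < x + int (Suc n) \<longleftrightarrow> (x \<le> a \<and> a < x + int n) \<or> a = x + int n" for a
    by auto
  then have eq: "{hedge a y | a. x \<le> a \<and> a < x + int (Suc n)} =
      {hedge a y | a. (x \<le> a \<and> a < x + int n) \<or> a = x + int n}"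
    by presburger
  have last: "walk_edges ((x, y) + sum_list (replicate n E)) [E] = {hedge (x + int n) y}"
    by (simp add: sum_list_replicate_point hedge_def)
  show ?case unfolding r walk_edges_append Suc.IH eq last
    by blast
qed simp

lemma walk_edges_NW:
  "walk_edges (x, y) (replicate n NW) = {wedge (x - k) (y + k) | k. 0 \<le> k \<and> k < int n}"
proof (induction n)
  case (Suc n)
  have r: "replicate (Suc n) NW = replicate n NW @ [NW]"
    by (simp add: replicate_append_same)
  have "0 \<le> k \<and> k < int (Suc n) \<longleftrightarrow> (0 \<le> k \<and> k < int n) \<or> k = int n" for k
    by auto
  then have eq: "{wedge (x - k) (y + k) | k. 0 \<le> k \<and> k < int (Suc n)} =
      {wedge (x - k) (y + k) | k. (0 \<le> k \<and> k < int n) \<or> k = int n}"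
    by presburger
  have last: "walk_edges ((x, y) + sum_list (replicate n NW)) [NW] = {wedge (x - int n) (y + int n)}"
    by (simp add: sum_list_replicate_point wedge_def)
  show ?case unfolding r walk_edges_append Suc.IH eq last
    by blast
qed simp

lemma lower_right_prefix:
  assumes "is_partition lam" "n \<le> length lam"
  defines "d \<equiv> length lam"
  defines "w \<equiv> concat (map (\<lambda>i. replicate (nth_part lam i - nth_part lam (Suc i)) E @ [NE])
       (rev [Suc (d - n)..<Suc d]))"
  shows "sum_list w = (int (nth_part lam (Suc (d - n))), int n) \<and>
    walk_edges (0, 0) w =
      {hedge a (int j) | a j. j < n \<and>
         int (nth_part lam (Suc (d - j))) \<le> a \<and> a < int (nth_part lam (d - j))} \<union>
      {nedge (int (nth_part lam (d - j))) (int j) | j. j < n}"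
  using assms(2) unfolding w_def
proof (induction n)
  case 0
  then show ?case by (simp add: d_def nth_part_def zero_prod_def)
next
  case (Suc n)
  define w where "w = concat (map (\<lambda>i. replicate (nth_part lam i - nth_part lam (Suc i)) E @ [NE])
       (rev [Suc (d - n)..<Suc d]))"
  have n: "n < d" using Suc.prems by (simp add: d_def)
  have eq: "rev [Suc (d - Suc n)..<Suc d] = rev [Suc (d - n)..<Suc d] @ [d - n]"
    using n by (subst upt_conv_Cons) (auto simp: Suc_diff_Suc)
  have le: "nth_part lam (Suc (d - n)) \<le> nth_part lam (d - n)"
    using n by (intro nth_part_antimono assms(1)) auto
  have IH: "sum_list w = (int (nth_part lam (Suc (d - n))), int n)"
    "walk_edges (0, 0) w =
      {hedge a (int j) | a j. j < n \<and>
         int (nth_part lam (Suc (d - j))) \<le> a \<and> a < int (nth_part lam (d - j))} \<union>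
      {nedge (int (nth_part lam (d - j))) (int j) | j. j < n}"
    using Suc unfolding w_def by auto
  define v where "v = replicate (nth_part lam (d - n) - nth_part lam (Suc (d - n))) E @ [NE]"
  have v: "sum_list v = (int (nth_part lam (d - n)) - int (nth_part lam (Suc (d - n))), 1)"
    "walk_edges (int (nth_part lam (Suc (d - n))), int n) v =
      {hedge a (int n) | a. int (nth_part lam (Suc (d - n))) \<le> a \<and> a < int (nth_part lam (d - n))} \<union>
      {nedge (int (nth_part lam (d - n))) (int n)}"
    using le
    by (simp_all add: v_def walk_edges_append sum_list_replicate_point walk_edges_E nedge_def)
  have p: "(0, 0) + sum_list w = (int (nth_part lam (Suc (d - n))), int n)"
    by (simp add: IH)
  have wv: "walk_edges (0, 0) (w @ v) =
    walk_edges (0, 0) w \<union> walk_edges (int (nth_part lam (Suc (d - n))), int n) v"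
    by (simp only: walk_edges_append p)
  have c: "concat (map (\<lambda>i. replicate (nth_part lam i - nth_part lam (Suc i)) E @ [NE])
       (rev [Suc (d - Suc n)..<Suc d])) = w @ v"
    unfolding eq by (simp add: w_def v_def del: upt_Suc)
  have sd: "Suc (d - Suc n) = d - n" using n by auto
  show ?case unfolding c wv IH(2) v(2) less_Suc_eq
    by (intro conjI) (simp add: IH(1) v(1) sd, blast)
qed

lemma top_prefix:
  assumes "is_partition mu" "length mu \<le> length lam" "n \<le> length lam"
  defines "d \<equiv> length lam"
  defines "w \<equiv> concat (map (\<lambda>i. replicate (nth_part mu i - nth_part mu (Suc i)) E @ [NE, SE])
       (rev [Suc (d - n)..<Suc d]))"
  shows "sum_list w = (int (nth_part mu (Suc (d - n))) + int n, 0) \<and>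
    walk_edges (- int d, int d) w =
      {hedge a (int d) | a. - int d \<le> a \<and> a < int (nth_part mu (Suc (d - n))) + int n - int d \<and>
         (\<forall>i \<in> {Suc (d - n)..d}. a \<noteq> int (nth_part mu i) - int i)} \<union>
      {nedge (int (nth_part mu i) - int i) (int d) | i. i \<in> {Suc (d - n)..d}} \<union>
      {wedge (int (nth_part mu i) - int i + 1) (int d) | i. i \<in> {Suc (d - n)..d}}"
  using assms(3) unfolding w_def
proof (induction n)
  case 0
  then show ?case using assms(2) by (auto simp: d_def nth_part_def zero_prod_def)
next
  case (Suc n)
  define w where "w = concat (map (\<lambda>i. replicate (nth_part mu i - nth_part mu (Suc i)) E @ [NE, SE])
       (rev [Suc (d - n)..<Suc d]))"
  have n: "n < d" using Suc.prems by (simp add: d_def)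
  define m where "m = d - n"
  have m: "0 < m" "d - Suc n = m - 1" "Suc (m - 1) = m" "m \<le> d" "int n = int d - int m"
    using n by (auto simp: m_def)
  have eq: "rev [Suc (d - Suc n)..<Suc d] = rev [Suc (d - n)..<Suc d] @ [m]"
    using n by (subst upt_conv_Cons) (auto simp: Suc_diff_Suc m_def)
  have le: "nth_part mu (Suc m) \<le> nth_part mu m"
    using m by (intro nth_part_antimono assms(1)) auto
  have below: "int (nth_part mu i) - int i < int (nth_part mu m) - int m" if "i \<in> {Suc m..d}" for i
    using that m nth_part_antimono[OF assms(1), of m i] by auto
  have below': "int (nth_part mu i) - int i < int (nth_part mu (Suc m)) - int m" if "i \<in> {Suc m..d}" for i
    using that m nth_part_antimono[OF assms(1), of "Suc m" i] by auto
  have IH: "sum_list w = (int (nth_part mu (Suc m)) + int n, 0)"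
    "walk_edges (- int d, int d) w =
      {hedge a (int d) | a. - int d \<le> a \<and> a < int (nth_part mu (Suc m)) - int m \<and>
         (\<forall>i \<in> {Suc m..d}. a \<noteq> int (nth_part mu i) - int i)} \<union>
      {nedge (int (nth_part mu i) - int i) (int d) | i. i \<in> {Suc m..d}} \<union>
      {wedge (int (nth_part mu i) - int i + 1) (int d) | i. i \<in> {Suc m..d}}"
    using Suc unfolding w_def m_def[symmetric] m by (auto simp: d_def)
  have ins: "{m..d} = insert m {Suc m..d}" using m by auto
  have H: "{hedge a (int d) | a. - int d \<le> a \<and> a < int (nth_part mu m) + int (Suc n) - int d \<and>
         (\<forall>i \<in> {m..d}. a \<noteq> int (nth_part mu i) - int i)} =
      {hedge a (int d) | a. - int d \<le> a \<and> a < int (nth_part mu (Suc m)) - int m \<and>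
         (\<forall>i \<in> {Suc m..d}. a \<noteq> int (nth_part mu i) - int i)} \<union>
      {hedge a (int d) | a. int (nth_part mu (Suc m)) - int m \<le> a \<and> a < int (nth_part mu m) - int m}"
    (is "{hedge a _ | a. ?A a} = {hedge a _ | a. ?B a} \<union> {hedge a _ | a. ?C a}")
  proof -
    have "?A a \<longleftrightarrow> ?B a \<or> ?C a" for a
    proof -
      have "?A a \<longleftrightarrow> - int d \<le> a \<and> a < int (nth_part mu m) - int m \<and>
          (\<forall>i \<in> {Suc m..d}. a \<noteq> int (nth_part mu i) - int i)"
        unfolding ins using m by auto
      then show ?thesis using le m below' by force
    qed
    then show ?thesis by blast
  qed
  have N: "{f i | i. i \<in> {m..d}} = insert (f m) {f i | i. i \<in> {Suc m..d}}"
    for f :: "nat \<Rightarrow> point set"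
    unfolding ins by auto
  have pt: "(- int d, int d) + sum_list w = (int (nth_part mu (Suc m)) - int m, int d)"
    using m by (simp add: IH)
  define v where "v = replicate (nth_part mu m - nth_part mu (Suc m)) E @ [NE, SE]"
  have v: "sum_list v = (int (nth_part mu m) - int (nth_part mu (Suc m)) + 1, 0)"
    "walk_edges (int (nth_part mu (Suc m)) - int m, int d) v =
      {hedge a (int d) | a. int (nth_part mu (Suc m)) - int m \<le> a \<and> a < int (nth_part mu m) - int m} \<union>
      {nedge (int (nth_part mu m) - int m) (int d), wedge (int (nth_part mu m) - int m + 1) (int d)}"
    using le
    by (simp_all add: v_def walk_edges_append sum_list_replicate_point walk_edges_E nedge_def
        wedge_def of_nat_diff insert_commute)
  have wv: "walk_edges (- int d, int d) (w @ v) =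
    walk_edges (- int d, int d) w \<union> walk_edges (int (nth_part mu (Suc m)) - int m, int d) v"
    by (simp only: walk_edges_append pt)
  have c: "concat (map (\<lambda>i. replicate (nth_part mu i - nth_part mu (Suc i)) E @ [NE, SE])
       (rev [m..<Suc d])) = w @ v"
    unfolding eq[unfolded m(2,3)] by (simp add: w_def v_def del: upt_Suc)
  show ?case unfolding m(2,3) c wv IH(2) v(2) H N[of "\<lambda>i. nedge (int (nth_part mu i) - int i) (int d)"]
      N[of "\<lambda>i. wedge (int (nth_part mu i) - int i + 1) (int d)"]
    by (intro conjI) (simp add: IH(1) v(1), blast)
qed

lemma Up_in_nabla:
  "Up (a, b) \<in> nabla lam mu \<longleftrightarrow>
     (0 \<le> b \<and> b < int (length lam) \<and> - b \<le> a \<and> a < int (nth_part lam (length lam - nat b))) \<or>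
     (b = int (length lam) \<and> (\<exists>i\<in>{1..length lam}. a = int (nth_part mu i) - int i))"
proof -
  have "(\<exists>j<length lam. Up (a, b) \<in> region_row lam j) \<longleftrightarrow>
     0 \<le> b \<and> b < int (length lam) \<and> - b \<le> a \<and> a < int (nth_part lam (length lam - nat b))"
    (is "?L \<longleftrightarrow> ?R")
  proof
    assume ?R
    then show ?L by (intro exI[of _ "nat b"]) (auto simp: region_row_def)
  qed (auto simp: region_row_def)
  then show ?thesis by (auto simp: nabla_def peaks_def)
qed

lemma Down_in_nabla:
  "Down (a, b) \<in> nabla lam mu \<longleftrightarrow>
     0 \<le> b \<and> b < int (length lam) \<and> - b \<le> a \<and> a \<le> int (nth_part lam (length lam - nat b))"
proof -
  have "(\<exists>j<length lam. Down (a, b) \<in> region_row lam j) \<longleftrightarrow>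
     0 \<le> b \<and> b < int (length lam) \<and> - b \<le> a \<and> a \<le> int (nth_part lam (length lam - nat b))"
    (is "?L \<longleftrightarrow> ?R")
  proof
    assume ?R
    then show ?L by (intro exI[of _ "nat b"]) (auto simp: region_row_def)
  qed (auto simp: region_row_def)
  then show ?thesis by (auto simp: nabla_def peaks_def)
qed

lemma hedge_subset: "hedge a b \<subseteq> verts t \<longleftrightarrow> t = Up (a, b) \<or> t = Down (a + 1, b - 1)"
  by (cases t) (auto simp: hedge_def)

lemma nedge_subset: "nedge a b \<subseteq> verts t \<longleftrightarrow> t = Up (a, b) \<or> t = Down (a, b)"
  by (cases t) (auto simp: nedge_def)

lemma wedge_subset: "wedge a b \<subseteq> verts t \<longleftrightarrow> t = Up (a - 1, b) \<or> t = Down (a, b)"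
  by (cases t) (auto simp: wedge_def)

lemma card_edge: "card (hedge a b) = 2" "card (nedge a b) = 2" "card (wedge a b) = 2"
  by (auto simp: edge_defs)

lemma hedge_boundary:
  "hedge a b \<in> boundary R \<longleftrightarrow> (Up (a, b) \<in> R) \<noteq> (Down (a + 1, b - 1) \<in> R)"
  by (auto simp: boundary_def card_edge hedge_subset)

lemma nedge_boundary:
  "nedge a b \<in> boundary R \<longleftrightarrow> (Up (a, b) \<in> R) \<noteq> (Down (a, b) \<in> R)"
  by (auto simp: boundary_def card_edge nedge_subset)

lemma wedge_boundary:
  "wedge a b \<in> boundary R \<longleftrightarrow> (Up (a - 1, b) \<in> R) \<noteq> (Down (a, b) \<in> R)"
  by (auto simp: boundary_def card_edge wedge_subset)

lemma edge_cases:
  assumes "card e = 2" "e \<subseteq> verts t"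
  obtains a b where "e = hedge a b \<or> e = nedge a b \<or> e = wedge a b"
proof -
  obtain p q where pq: "e = {p, q}" "p \<noteq> q" using assms(1) by (auto simp: card_2_iff)
  show ?thesis
  proof (cases t)
    case (Up u)
    obtain a b where u: "u = (a, b)" by (cases u)
    have "e = hedge a b \<or> e = nedge a b \<or> e = wedge (a + 1) b"
      using assms(2) pq unfolding Up u by (auto simp: edge_defs)
    then show ?thesis using that by metis
  next
    case (Down u)
    obtain a b where u: "u = (a, b)" by (cases u)
    have "e = hedge (a - 1) (b + 1) \<or> e = nedge a b \<or> e = wedge a b"
      using assms(2) pq unfolding Down u by (auto simp: edge_defs)
    then show ?thesis using that by metis
  qed
qed

lemma edge_inj:
  "hedge a b = hedge a' b' \<longleftrightarrow> a = a' \<and> b = b'"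
  "nedge a b = nedge a' b' \<longleftrightarrow> a = a' \<and> b = b'"
  "wedge a b = wedge a' b' \<longleftrightarrow> a = a' \<and> b = b'"
  "hedge a b \<noteq> nedge a' b'" "hedge a b \<noteq> wedge a' b'" "nedge a b \<noteq> wedge a' b'"
  "nedge a b \<noteq> hedge a' b'" "wedge a b \<noteq> hedge a' b'" "wedge a b \<noteq> nedge a' b'"
  by (auto simp: edge_defs doubleton_eq_iff)

lemma boundary_nabla:
  assumes "is_partition lam" "is_partition mu" "diagram mu \<subseteq> diagram lam"
  shows "boundary (nabla lam mu) =
    walk_edges (0, 0) (left_steps lam) \<union>
    walk_edges (0, 0) (lower_right_steps lam) \<union>
    walk_edges ((0, 0) + sum_list (left_steps lam)) (top_steps lam mu)"
proof -
  define d where "d = length lam"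
  have le: "nth_part mu i \<le> nth_part lam i" if "1 \<le> i" for i
    using nth_part_mono_diagram[OF assms(2,3) that] .
  have len: "length mu \<le> length lam"
  proof (rule ccontr)
    assume "\<not> ?thesis"
    then have "nth_part mu (length mu) = 0" "length mu > 0"
      using le[of "length mu"] by (auto simp: nth_part_def split: if_splits)
    then show False
      using assms(2) by (auto simp: nth_part_def is_partition_def)
        (metis One_nat_def Suc_pred diff_Suc_less length_greater_0_conv nth_mem)
  qed
  have L: "walk_edges (0, 0) (left_steps lam) = {wedge (- k) k | k. 0 \<le> k \<and> k < int d}"
    using walk_edges_NW[of 0 0] by (simp add: left_steps_def d_def)
  have S: "walk_edges (0, 0) (lower_right_steps lam) =
      {hedge a (int j) | a j. j < d \<and>
         int (nth_part lam (Suc (d - j))) \<le> a \<and> a < int (nth_part lam (d - j))} \<union>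
      {nedge (int (nth_part lam (d - j))) (int j) | j. j < d}"
    using lower_right_prefix[OF assms(1) order_refl]
    by (simp add: lower_right_steps_def d_def)
  have st: "(0, 0) + sum_list (left_steps lam) = (- int d, int d)"
    by (simp add: left_steps_def sum_list_replicate_point d_def)
  define w where "w = concat (map (\<lambda>i. replicate (nth_part mu i - nth_part mu (Suc i)) E @ [NE, SE])
       (rev [1..<Suc d]))"
  have w: "sum_list w = (int (nth_part mu 1) + int d, 0)"
    "walk_edges (- int d, int d) w =
      {hedge a (int d) | a. - int d \<le> a \<and> a < int (nth_part mu 1) \<and>
         (\<forall>i \<in> {1..d}. a \<noteq> int (nth_part mu i) - int i)} \<union>
      {nedge (int (nth_part mu i) - int i) (int d) | i. i \<in> {1..d}} \<union>
      {wedge (int (nth_part mu i) - int i + 1) (int d) | i. i \<in> {1..d}}"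
    using top_prefix[OF assms(2) len order_refl] by (simp_all add: w_def d_def)
  have bound: "int (nth_part mu i) - int i < int (nth_part mu 1)" if "i \<in> {1..d}" for i
    using nth_part_antimono[OF assms(2), of 1 i] that by auto
  have "walk_edges (- int d, int d) (top_steps lam mu) =
      walk_edges (- int d, int d) w \<union>
      {hedge a (int d) | a. int (nth_part mu 1) \<le> a \<and> a < int (nth_part lam 1)}"
  proof -
    have pt: "(- int d, int d) + sum_list w = (int (nth_part mu 1), int d)"
      by (simp add: w(1))
    have "int (nth_part mu 1) + int (nth_part lam 1 - nth_part mu 1) = int (nth_part lam 1)"
      using le[of 1] by simp
    then show ?thesis
      unfolding top_steps_def d_def[symmetric] w_def[symmetric] walk_edges_append pt walk_edges_E
      by simp
  qed
  also have "\<dots> =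
      {hedge a (int d) | a. - int d \<le> a \<and> a < int (nth_part lam 1) \<and>
         (\<forall>i \<in> {1..d}. a \<noteq> int (nth_part mu i) - int i)} \<union>
      {nedge (int (nth_part mu i) - int i) (int d) | i. i \<in> {1..d}} \<union>
      {wedge (int (nth_part mu i) - int i + 1) (int d) | i. i \<in> {1..d}}"
  proof -
    have "- int d \<le> a \<and> a < int (nth_part lam 1) \<and> (\<forall>i \<in> {1..d}. a \<noteq> int (nth_part mu i) - int i) \<longleftrightarrow>
      (- int d \<le> a \<and> a < int (nth_part mu 1) \<and> (\<forall>i \<in> {1..d}. a \<noteq> int (nth_part mu i) - int i)) \<or>
      (int (nth_part mu 1) \<le> a \<and> a < int (nth_part lam 1))" for a
      using le[of 1] bound by (smt (verit) of_nat_0_le_iff of_nat_mono order_refl)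
    then show ?thesis unfolding w(2) by blast
  qed
  finally have T: "walk_edges (- int d, int d) (top_steps lam mu) = \<dots>" .
  note U = Up_in_nabla[of _ _ lam mu, folded d_def] Down_in_nabla[of _ _ lam mu, folded d_def]
  let ?W = "walk_edges (0, 0) (left_steps lam) \<union> walk_edges (0, 0) (lower_right_steps lam) \<union>
     walk_edges ((0, 0) + sum_list (left_steps lam)) (top_steps lam mu)"
  have W1: "hedge a b \<in> ?W \<longleftrightarrow>
      (\<exists>j<d. b = int j \<and> int (nth_part lam (Suc (d - j))) \<le> a \<and> a < int (nth_part lam (d - j))) \<or>
      (b = int d \<and> - int d \<le> a \<and> a < int (nth_part lam 1) \<and>
        (\<forall>i \<in> {1..d}. a \<noteq> int (nth_part mu i) - int i))" for a b
    unfolding st L S T by (simp only: Un_iff mem_Collect_eq edge_inj simp_thms) blast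
  have W2: "nedge a b \<in> ?W \<longleftrightarrow> (\<exists>j<d. b = int j \<and> a = int (nth_part lam (d - j))) \<or>
       (b = int d \<and> (\<exists>i\<in>{1..d}. a = int (nth_part mu i) - int i))" for a b
    unfolding st L S T by (simp only: Un_iff mem_Collect_eq edge_inj simp_thms) blast
  have W3: "wedge a b \<in> ?W \<longleftrightarrow> (0 \<le> b \<and> b < int d \<and> a = - b) \<or>
       (b = int d \<and> (\<exists>i\<in>{1..d}. a = int (nth_part mu i) - int i + 1))" for a b
    unfolding st L S T by (auto simp: edge_inj)
  note W = W1 W2 W3
  have h: "hedge a b \<in> boundary (nabla lam mu) \<longleftrightarrow> hedge a b \<in> ?W" for a b
  proof -
    consider "b < 0" | "b > int d" | "b = int d" "d > 0" | "b = 0" "0 < d" | "b = 0" "d = 0"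
      | j where "b = int j" "0 < j" "j < d"
    proof (cases "b < 0 \<or> b > int d")
      case False
      then have "b = int (nat b)" "nat b \<le> d" by auto
      then show ?thesis using that(3-6) by (metis le_neq_implies_less neq0_conv of_nat_0)
    qed (use that in blast)
    then show ?thesis
    proof cases
      case 3
      have peak: "- int d \<le> a \<and> a < int (nth_part lam 1)"
        if "\<exists>i\<in>{1..d}. a = int (nth_part mu i) - int i"
        using that bound le[of 1] by fastforce
      have "Up (a, b) \<in> nabla lam mu \<longleftrightarrow> (\<exists>i\<in>{1..d}. a = int (nth_part mu i) - int i)"
        using 3 unfolding U by auto
      moreover have "Down (a + 1, b - 1) \<in> nabla lam mu \<longleftrightarrow> - int d \<le> a \<and> a < int (nth_part lam 1)"
      proof -
        have "d - nat (int d - 1) = 1" using 3 by auto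
        then show ?thesis using 3 unfolding U by auto
      qed
      moreover have "hedge a b \<in> ?W \<longleftrightarrow> - int d \<le> a \<and> a < int (nth_part lam 1) \<and>
          \<not> (\<exists>i\<in>{1..d}. a = int (nth_part mu i) - int i)"
        using 3 unfolding W by auto
      ultimately show ?thesis unfolding hedge_boundary using peak by blast
    next
      case 4
      then show ?thesis unfolding hedge_boundary W U by (auto simp: nth_part_def d_def)
    next
      case 6
      have "d - nat (int j - 1) = Suc (d - j)" using 6 by auto
      moreover have "nth_part lam (Suc (d - j)) \<le> nth_part lam (d - j)"
        using 6 by (intro nth_part_antimono assms(1)) auto
      ultimately show ?thesis
        using 6 unfolding hedge_boundary W U by auto
    qed (unfold hedge_boundary W U, auto simp: nth_part_def d_def)
  qed
  have n: "nedge a b \<in> boundary (nabla lam mu) \<longleftrightarrow> nedge a b \<in> ?W" for a b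
  proof (cases "0 \<le> b")
    case True
    then obtain j where "b = int j" using nonneg_int_cases by blast
    then show ?thesis unfolding nedge_boundary W U by auto
  qed (unfold nedge_boundary W U, auto)
  have v: "wedge a b \<in> boundary (nabla lam mu) \<longleftrightarrow> wedge a b \<in> ?W" for a b
  proof -
    have "a - 1 = x \<longleftrightarrow> a = x + 1" for x by auto
    then show ?thesis unfolding wedge_boundary W U by auto
  qed
  have W_cases: "\<exists>a b. e = hedge a b \<or> e = nedge a b \<or> e = wedge a b" if "e \<in> ?W" for e
    using that unfolding st L S T by blast
  show ?thesis
  proof (intro set_eqI iffI)
    fix e assume e: "e \<in> boundary (nabla lam mu)"
    then obtain t where "card e = 2" "e \<subseteq> verts t" unfolding boundary_def by blast
    then show "e \<in> ?W" using edge_cases e h n v by metis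
  next
    fix e assume "e \<in> ?W"
    then show "e \<in> boundary (nabla lam mu)" using W_cases h n v by metis
  qed
qed

end

theory Submission
  imports Defs
begin

text \<open>
  Let \<open>d\<close> be the number of parts of \<open>\<lambda>\<close>, and encode the two partitions by the strictly increasing
  sequences \<open>x\<^sub>j = \<lambda>\<^bsub>d-j\<^esub> + j\<close> and \<open>m\<^sub>j = \<mu>\<^bsub>d-j\<^esub> + j\<close> for \<open>j < d\<close> (their beta numbers). The proof compares both
  sides of the formula with one function \<open>S(m)\<close>, the \<open>interlacing_sum\<close>, which is the shifted Schur function
  of \<open>\<mu>\<close> evaluated at \<open>\<lambda>\<close>, presented through its branching rule.

  The tilings give \<open>S(m)\<close>. If triangles are counted from the left boundary, row \<open>j\<close> is a chain of
  \<open>x\<^sub>j + 1\<close> downward and \<open>x\<^sub>j\<close> upward triangles in alternation, and the peaks sit above the downward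
  triangles number \<open>m\<^sub>0 < m\<^sub>1 < \<dots>\<close> of the top row. A peak can only be tiled together with the downward triangle
  below it. This cuts the chain of the top row into pieces, and between \<open>m\<^sub>j\<close> and \<open>m\<^bsub>j+1\<^esub>\<close> exactly one
  upward triangle, number \<open>n\<^sub>j\<close> say, has no partner in its row. Its position determines the tiling of the piece, with the
  NW-SE lozenges to its right, and it acts as a peak for the rows below. Hence a tiling is a tower of interlacing
  sequences, and its weight is the product of the factors \<open>x\<^sub>j - c\<close> over the gaps of the tower
  (\<open>tiling_sum_eq_interlacing_sum\<close>).

  The function \<open>S\<close> obeys a Pieri rule: raising one entry of \<open>m\<close> by one in all possible ways gives
  \<open>\<Sum>\<^sub>j S(m + e\<^sub>j) = (\<Sum>x - \<Sum>m) S(m)\<close> (\<open>interlacing_sum_recurrence\<close>). The inner sum over each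
  \<open>n\<^sub>j\<close> telescopes, and what telescoping leaves at the ends are the terms that a shift of \<open>m\<close> gains
  or loses. As \<open>\<Sum>x - \<Sum>m\<close> is the size of \<open>\<lambda>/\<mu>\<close>, and as the terms in which \<open>m + e\<^sub>j\<close> is not
  strictly increasing or exceeds \<open>x\<close> vanish, \<open>S(m)\<close> times \<open>|\<lambda>/\<mu>|!\<close> satisfies the same
  recursion as the number of standard tableaux, which is reduced to smaller shapes by deleting the smallest
  entry. Both recursions end at \<open>\<mu> = \<lambda>\<close>. There only one tower contributes, and \<open>S(x)\<close>
  is the product over \<open>j\<close> of \<open>x\<^sub>j - c\<close> with \<open>c < x\<^sub>j\<close> not a beta number: this is the product of the hook lengths (\<open>prod_hook_lengths\<close>), which is the
  constant of proportionality.
\<close>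

section \<open>Weighted interlacing sums\<close>

definition interlacing :: "nat \<Rightarrow> (nat \<Rightarrow> nat) \<Rightarrow> (nat \<Rightarrow> nat) set" where
  "interlacing k m = (\<Pi>\<^sub>E j\<in>{..<k}. {m j..<m (Suc j)})"

text \<open>The factor by which one row of a tiling contributes: the entries of \<open>n\<close> separate, between each two
  neighbouring entries of \<open>m\<close>, the numbers that give a factor from those that do not.\<close>

definition row_weight :: "nat \<Rightarrow> nat \<Rightarrow> (nat \<Rightarrow> nat) \<Rightarrow> (nat \<Rightarrow> nat) \<Rightarrow> real" where
  "row_weight p k m n =
     (\<Prod>c<m 0. real p - real c) * (\<Prod>j<k. \<Prod>c\<in>{Suc (n j)..<m (Suc j)}. real p - real c)"

text \<open>For distinct \<open>x\<^sub>i\<close> and strictly increasing \<open>m\<close> this is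
  \<open>det (x\<^sub>i \<down> m\<^sub>j) / det (x\<^sub>i \<down> j)\<close>, where \<open>\<down>\<close> is the falling power:
  subtracting multiples of neighbouring columns so as to clear the row of \<open>x\<^sub>k\<close>, and expanding along it,
  yields the recursion.\<close>

fun interlacing_sum :: "(nat \<Rightarrow> nat) \<Rightarrow> nat \<Rightarrow> (nat \<Rightarrow> nat) \<Rightarrow> real" where
  "interlacing_sum x 0 m = 1"
| "interlacing_sum x (Suc k) m = (\<Sum>n\<in>interlacing k m. row_weight (x k) k m n * interlacing_sum x k n)"

lemma finite_interlacing [simp]: "finite (interlacing k m)"
  by (auto simp: interlacing_def intro!: finite_PiE)

lemma interlacing_sum_cong:
  assumes "\<And>i. i < k \<Longrightarrow> m i = m' i"
  shows "interlacing_sum x k m = interlacing_sum x k m'"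
proof (cases k)
  case (Suc k')
  have "interlacing k' m = interlacing k' m'"
    using assms Suc by (auto simp: interlacing_def intro!: PiE_cong)
  moreover have "row_weight p k' m n = row_weight p k' m' n" for p n
    using assms Suc by (auto simp: row_weight_def intro!: prod.cong)
  ultimately show ?thesis using Suc by simp
qed simp

text \<open>Two equal neighbours leave no room for an entry between them.\<close>

lemma interlacing_sum_repeated:
  assumes "Suc j < k" "m j = m (Suc j)"
  shows "interlacing_sum x k m = 0"
proof -
  obtain k' where k: "k = Suc k'" "j < k'" using assms by (cases k) auto
  have "interlacing k' m = {}"
    using k assms(2) unfolding interlacing_def PiE_eq_empty_iff by force
  then show ?thesis using k by simp
qed

lemma interlacing_strict:
  assumes "n \<in> interlacing k m" "Suc i < k"
  shows "n i < n (Suc i)"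
proof -
  have "n i \<in> {m i..<m (Suc i)}" "n (Suc i) \<in> {m (Suc i)..<m (Suc (Suc i))}"
    using assms by (auto simp: interlacing_def PiE_iff simp del: atLeastLessThan_iff)
  then show ?thesis by auto
qed

text \<open>Entries of an interlacing sequence are not below those of \<open>m\<close>, so an excess of \<open>m\<close> over \<open>x\<close> is
  inherited by the shorter sequences, unless it occurs at the last entry. In that case, the largest gap contains
  \<open>x\<^sub>k\<close>, or else the excess appears at the last entry of the shorter sequence.\<close>

lemma interlacing_sum_vanish:
  assumes "\<And>i. Suc i < k \<Longrightarrow> x i < x (Suc i)" "i < k" "x i < m i"
  shows "interlacing_sum x k m = 0"
  using assms
proof (induction k arbitrary: i m)
  case (Suc k)
  have "row_weight (x k) k m n * interlacing_sum x k n = 0" if n: "n \<in> interlacing k m" for n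
  proof (cases "i < k")
    case True
    have "m i \<le> n i" using n True by (auto simp: interlacing_def PiE_iff)
    then have "interlacing_sum x k n = 0" using Suc.IH[of i n] Suc.prems True by auto
    then show ?thesis by simp
  next
    case False
    then have i: "i = k" using Suc.prems by simp
    show ?thesis
    proof (cases k)
      case 0
      then have "row_weight (x k) k m n = 0"
        using Suc.prems i by (auto simp: row_weight_def)
      then show ?thesis by simp
    next
      case (Suc k')
      show ?thesis
      proof (cases "x k' < n k'")
        case True
        then have "interlacing_sum x k n = 0" using Suc.IH[of k' n] Suc.prems \<open>k = Suc k'\<close> by auto
        then show ?thesis by simp
      next
        case False
        have "x k' < x k" using Suc.prems(1)[of k'] \<open>k = Suc k'\<close> by simp
        then have "x k \<in> {Suc (n k')..<m (Suc k')}"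
          using False Suc.prems(3) i \<open>k = Suc k'\<close>[symmetric] by simp
        then have "(\<Prod>c\<in>{Suc (n k')..<m (Suc k')}. real (x k) - real c) = 0"
          by (intro prod_zero) auto
        then have "(\<Prod>j<k. \<Prod>c\<in>{Suc (n j)..<m (Suc j)}. real (x k) - real c) = 0"
          using \<open>k = Suc k'\<close> by (intro prod_zero) auto
        then have "row_weight (x k) k m n = 0"
          by (auto simp: row_weight_def)
        then show ?thesis by simp
      qed
    qed
  qed
  then show ?case by (simp add: sum.neutral)
qed simp

lemma sum_PiE_separate:
  assumes "finite A" "j \<in> A" "\<And>i. i \<in> A \<Longrightarrow> finite (B i)"
  shows "(\<Sum>n\<in>Pi\<^sub>E A B. f n) = (\<Sum>n\<in>Pi\<^sub>E (A - {j}) B. \<Sum>c\<in>B j. f (n(j := c)))"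
proof -
  have A: "A = insert j (A - {j})" using assms(2) by auto
  have "(\<Sum>n\<in>Pi\<^sub>E A B. f n) = (\<Sum>n\<in>(\<lambda>(c, n). n(j := c)) ` (B j \<times> Pi\<^sub>E (A - {j}) B). f n)"
    by (subst A, subst PiE_insert_eq) simp
  also have "\<dots> = (\<Sum>(c, n)\<in>B j \<times> Pi\<^sub>E (A - {j}) B. f (n(j := c)))"
    using inj_combinator[of j "A - {j}" B] by (subst sum.reindex) (auto simp: case_prod_unfold)
  also have "\<dots> = (\<Sum>c\<in>B j. \<Sum>n\<in>Pi\<^sub>E (A - {j}) B. f (n(j := c)))"
    by (simp add: sum.cartesian_product)
  also have "\<dots> = (\<Sum>n\<in>Pi\<^sub>E (A - {j}) B. \<Sum>c\<in>B j. f (n(j := c)))"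
    by (rule sum.swap)
  finally show ?thesis .
qed

lemma row_weight_upd:
  assumes "j < k"
  shows "row_weight p k m (n(j := c)) =
    (\<Prod>c<m 0. real p - real c) *
    (\<Prod>i\<in>{..<k}-{j}. \<Prod>c\<in>{Suc (n i)..<m (Suc i)}. real p - real c) *
    (\<Prod>c\<in>{Suc c..<m (Suc j)}. real p - real c)"
proof -
  have "(\<Prod>i\<in>{..<k}-{j}. \<Prod>c\<in>{Suc ((n(j := c)) i)..<m (Suc i)}. real p - real c) =
     (\<Prod>i\<in>{..<k}-{j}. \<Prod>c\<in>{Suc (n i)..<m (Suc i)}. real p - real c)"
    by (intro prod.cong) auto
  then show ?thesis using assms
    unfolding row_weight_def by (subst prod.remove[of _ j]) (simp_all del: fun_upd_apply, simp)
qed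

abbreviation incr :: "(nat \<Rightarrow> nat) \<Rightarrow> nat \<Rightarrow> nat \<Rightarrow> nat" where
  "incr m j \<equiv> m(j := Suc (m j))"

text \<open>The part of the sum over interlacing sequences that lies on the face where entry \<open>j\<close> equals \<open>c\<close>. The value
  \<open>c = m (Suc j)\<close>, one step outside the range of entry \<open>j\<close>, is needed as well.\<close>

definition facet :: "(nat \<Rightarrow> nat) \<Rightarrow> nat \<Rightarrow> (nat \<Rightarrow> nat) \<Rightarrow> nat \<Rightarrow> nat \<Rightarrow> real" where
  "facet x k m j c = (\<Sum>n\<in>Pi\<^sub>E ({..<k} - {j}) (\<lambda>j. {m j..<m (Suc j)}).
     row_weight (x k) k m (n(j := c)) * interlacing_sum x k (n(j := c)))"

text \<open>With all entries but \<open>c = n\<^sub>j\<close> fixed, the gap to the right of \<open>c\<close> has the weight \<open>W(c)\<close> with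
  \<open>W(c) (p - c) = W(c - 1)\<close>. So the summand is a difference \<open>h(c) - h(c + 1)\<close>, and the sum over \<open>c\<close> reduces to
  the two faces that bound the range of \<open>c\<close>.\<close>

lemma telescope_interlacing:
  assumes "j < k" "m j < m (Suc j)"
  shows "(\<Sum>n\<in>interlacing k m. row_weight (x k) k m n *
      ((real (x k) - real (n j)) * interlacing_sum x k n - interlacing_sum x k (incr n j))) =
    (real (x k) - real (m j)) * facet x k m j (m j) - facet x k m j (m (Suc j))"
proof -
  define B where "B = (\<lambda>j. {m j..<m (Suc j)})"
  have "(\<Sum>n\<in>interlacing k m. row_weight (x k) k m n *
      ((real (x k) - real (n j)) * interlacing_sum x k n - interlacing_sum x k (incr n j))) =
    (\<Sum>n\<in>Pi\<^sub>E ({..<k} - {j}) B. \<Sum>c\<in>B j. row_weight (x k) k m (n(j := c)) *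
      ((real (x k) - real c) * interlacing_sum x k (n(j := c)) - interlacing_sum x k (n(j := Suc c))))"
    unfolding interlacing_def B_def using assms by (subst sum_PiE_separate[of _ j]) auto
  also have "\<dots> = (\<Sum>n\<in>Pi\<^sub>E ({..<k} - {j}) B.
      (real (x k) - real (m j)) * (row_weight (x k) k m (n(j := m j)) * interlacing_sum x k (n(j := m j))) -
      row_weight (x k) k m (n(j := m (Suc j))) * interlacing_sum x k (n(j := m (Suc j))))"
  proof (rule sum.cong)
    fix n
    define C where "C = (\<Prod>c<m 0. real (x k) - real c) *
      (\<Prod>i\<in>{..<k}-{j}. \<Prod>c\<in>{Suc (n i)..<m (Suc i)}. real (x k) - real c)"
    define h where "h c = C * (\<Prod>e\<in>{c..<m (Suc j)}. real (x k) - real e) * interlacing_sum x k (n(j := c))" for c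
    have rw: "row_weight (x k) k m (n(j := c)) = C * (\<Prod>e\<in>{Suc c..<m (Suc j)}. real (x k) - real e)" for c
      unfolding row_weight_upd[OF assms(1)] C_def ..
    have st: "(\<Prod>e\<in>{c..<m (Suc j)}. real (x k) - real e) =
       (real (x k) - real c) * (\<Prod>e\<in>{Suc c..<m (Suc j)}. real (x k) - real e)"
       if "c < m (Suc j)" for c
      using prod.atLeast_Suc_lessThan[OF that] .
    have "(\<Sum>c\<in>B j. row_weight (x k) k m (n(j := c)) *
      ((real (x k) - real c) * interlacing_sum x k (n(j := c)) - interlacing_sum x k (n(j := Suc c)))) =
      (\<Sum>c\<in>B j. h c - h (Suc c))"
      unfolding h_def rw
      by (intro sum.cong refl) (auto simp: B_def st algebra_simps)
    also have "\<dots> = h (m j) - h (m (Suc j))"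
      unfolding B_def using sum_Suc_diff'[of "m j" "m (Suc j)" "\<lambda>c. - h c"] assms by simp
    finally show "(\<Sum>c\<in>B j. row_weight (x k) k m (n(j := c)) *
      ((real (x k) - real c) * interlacing_sum x k (n(j := c)) - interlacing_sum x k (n(j := Suc c)))) =
      (real (x k) - real (m j)) * (row_weight (x k) k m (n(j := m j)) * interlacing_sum x k (n(j := m j))) -
      row_weight (x k) k m (n(j := m (Suc j))) * interlacing_sum x k (n(j := m (Suc j)))"
      unfolding h_def rw using st[of "m j"] assms by simp
  qed simp
  also have "\<dots> = (real (x k) - real (m j)) * facet x k m j (m j) - facet x k m j (m (Suc j))"
    unfolding facet_def B_def by (simp add: sum_subtractf sum_distrib_left)
  finally show ?thesis .
qed

text \<open>Moving \<open>m\<^sub>j\<close> to the right adds the number \<open>m\<^sub>j\<close> to the gap on its left.\<close>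

lemma row_weight_incr:
  assumes "j \<le> k" "0 < j \<Longrightarrow> n (j - 1) < m j"
  shows "row_weight p k (incr m j) n = (real p - real (m j)) * row_weight p k m n"
proof (cases j)
  case 0
  then show ?thesis by (simp add: row_weight_def)
next
  case (Suc i)
  have "(\<Prod>l<k. \<Prod>c\<in>{Suc (n l)..<(incr m j) (Suc l)}. real p - real c) =
     (\<Prod>l<k. (\<Prod>c\<in>{Suc (n l)..<m (Suc l)}. real p - real c) * (if l = i then real p - real (m j) else 1))"
    using assms Suc by (intro prod.cong) (auto simp: atLeastLessThanSuc mult.commute)
  also have "\<dots> = (\<Prod>l<k. (\<Prod>c\<in>{Suc (n l)..<m (Suc l)}. real p - real c)) * (real p - real (m j))"
    using assms Suc by (subst prod.distrib) (simp add: prod.delta)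
  finally show ?thesis using Suc by (simp add: row_weight_def)
qed

text \<open>If \<open>n\<^sub>j = m\<^bsub>j+1\<^esub>\<close>, the gap between them is empty before and after the shift.\<close>

lemma row_weight_incr_edge:
  assumes "j < k" "n j = m (Suc j)"
  shows "row_weight p k (incr m (Suc j)) n = row_weight p k m n"
proof -
  have "(\<Prod>l<k. \<Prod>c\<in>{Suc (n l)..<(incr m (Suc j)) (Suc l)}. real p - real c) =
     (\<Prod>l<k. \<Prod>c\<in>{Suc (n l)..<m (Suc l)}. real p - real c)"
    using assms by (intro prod.cong) auto
  then show ?thesis by (simp add: row_weight_def)
qed

lemma sum_PiE_fixed:
  assumes "finite A" "j \<in> A" "\<And>i. i \<in> A \<Longrightarrow> finite (B i)" "c \<in> B j"
  shows "(\<Sum>n\<in>{n \<in> Pi\<^sub>E A B. n j = c}. f n) = (\<Sum>n\<in>Pi\<^sub>E (A - {j}) B. f (n(j := c)))"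
proof -
  have "(\<Sum>n\<in>{n \<in> Pi\<^sub>E A B. n j = c}. f n) = (\<Sum>n\<in>Pi\<^sub>E A B. if n j = c then f n else 0)"
    using assms by (subst sum.inter_filter) (auto intro!: finite_PiE)
  also have "\<dots> = (\<Sum>n\<in>Pi\<^sub>E (A - {j}) B. \<Sum>e\<in>B j. if e = c then f (n(j := e)) else 0)"
    using assms by (subst sum_PiE_separate[of A j]) auto
  also have "\<dots> = (\<Sum>n\<in>Pi\<^sub>E (A - {j}) B. f (n(j := c)))"
    using assms by (intro sum.cong) (auto simp: sum.delta)
  finally show ?thesis .
qed

text \<open>Shifting \<open>m\<^sub>j\<close> changes the ranges of two entries: \<open>n\<^sub>j\<close> can no longer be \<open>m\<^sub>j\<close>, and
  \<open>n\<^bsub>j-1\<^esub>\<close> can now be \<open>m\<^sub>j\<close>. Apart from these two faces, the shift only multiplies every term by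
  \<open>p - m\<^sub>j\<close>.\<close>

lemma interlacing_sum_incr:
  assumes "\<And>i. i < k \<Longrightarrow> m i < m (Suc i)" "j \<le> k"
  shows "interlacing_sum x (Suc k) (incr m j) = (real (x k) - real (m j)) * interlacing_sum x (Suc k) m
     - (if j < k then (real (x k) - real (m j)) * facet x k m j (m j) else 0)
     + (if 0 < j then facet x k m (j - 1) (m j) else 0)"
proof -
  define B where "B = (\<lambda>i. {m i..<m (Suc i)})"
  define B' where "B' = (\<lambda>i. if Suc i = j then {m i..m j} else B i)"
  \<comment> \<open>the common superset in which both families of sequences are cut out by one inequation\<close>
  define K where "K = Pi\<^sub>E {..<k} B'"
  define f where "f n = row_weight (x k) k (incr m j) n * interlacing_sum x k n" for n
  have fK: "finite K" unfolding K_def by (intro finite_PiE) (auto simp: B'_def B_def)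
  have BB: "B i = (if Suc i = j then B' i - {m j} else B' i)" for i
    by (auto simp: B'_def B_def)
  have I1: "interlacing k m = {n \<in> K. \<not> (0 < j \<and> n (j - 1) = m j)}"
  proof -
    have "n \<in> interlacing k m \<longleftrightarrow> n \<in> extensional {..<k} \<and> (\<forall>i<k. n i \<in> B i)" for n
      by (auto simp: interlacing_def B_def PiE_iff)
    moreover have "n \<in> K \<and> \<not> (0 < j \<and> n (j - 1) = m j) \<longleftrightarrow>
       n \<in> extensional {..<k} \<and> (\<forall>i<k. n i \<in> B i)" for n
      unfolding K_def PiE_iff BB using assms(2) by (cases j) auto
    ultimately show ?thesis by auto
  qed
  have I2: "interlacing k (incr m j) = {n \<in> K. \<not> (j < k \<and> n j = m j)}"
  proof -
    have "n i \<in> {(incr m j) i..<(incr m j) (Suc i)} \<longleftrightarrow> n i \<in> B' i \<and> \<not> (i = j \<and> n j = m j)"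
      if "i < k" for i and n :: "nat \<Rightarrow> nat"
      using assms(1)[OF that] by (auto simp: B'_def B_def)
    then have "(\<forall>i\<in>{..<k}. n i \<in> {(incr m j) i..<(incr m j) (Suc i)}) \<longleftrightarrow>
        (\<forall>i\<in>{..<k}. n i \<in> B' i) \<and> \<not> (j < k \<and> n j = m j)" for n :: "nat \<Rightarrow> nat"
      by (metis lessThan_iff)
    then show ?thesis
      unfolding interlacing_def K_def set_eq_iff PiE_iff mem_Collect_eq by metis
  qed
  \<comment> \<open>where the two faces meet, the shorter sequence has a repeated entry\<close>
  have zero: "f n = 0" if "j < k" "0 < j" "n j = m j" "n (j - 1) = m j" for n
    using interlacing_sum_repeated[of "j - 1" k n] that by (simp add: f_def)
  have s1: "(\<Sum>n\<in>K. f n) = (\<Sum>n\<in>interlacing k m. f n) + (\<Sum>n\<in>{n\<in>K. 0 < j \<and> n (j - 1) = m j}. f n)"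
    unfolding I1 by (subst sum.union_disjoint[symmetric]) (auto intro!: sum.cong fK finite_subset[OF _ fK])
  have s2: "(\<Sum>n\<in>K. f n) = (\<Sum>n\<in>interlacing k (incr m j). f n) + (\<Sum>n\<in>{n\<in>K. j < k \<and> n j = m j}. f n)"
    unfolding I2 by (subst sum.union_disjoint[symmetric]) (auto intro!: sum.cong fK finite_subset[OF _ fK])
  have t0: "(\<Sum>n\<in>interlacing k (incr m j). f n) = interlacing_sum x (Suc k) (incr m j)"
    by (simp add: f_def)
  have fI: "f n = (real (x k) - real (m j)) * (row_weight (x k) k m n * interlacing_sum x k n)"
    if "n \<in> interlacing k m" for n
  proof -
    have "n (j - 1) < m j" if "0 < j"
    proof -
      have "n (j - 1) \<in> {m (j - 1)..<m (Suc (j - 1))}"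
        using \<open>n \<in> interlacing k m\<close> that assms(2)
        unfolding interlacing_def PiE_iff by (metis Suc_le_eq Suc_pred' lessThan_iff)
      then show ?thesis using that by simp
    qed
    then show ?thesis unfolding f_def using row_weight_incr[of j k n m "x k"] assms(2) by simp
  qed
  have t1: "(\<Sum>n\<in>interlacing k m. f n) = (real (x k) - real (m j)) * interlacing_sum x (Suc k) m"
    by (simp add: fI sum_distrib_left cong: sum.cong)
  have t2: "(\<Sum>n\<in>{n\<in>K. j < k \<and> n j = m j}. f n) =
      (if j < k then (real (x k) - real (m j)) * facet x k m j (m j) else 0)"
  proof (cases "j < k")
    case True
    have "(\<Sum>n\<in>{n\<in>K. j < k \<and> n j = m j}. f n) = (\<Sum>n\<in>{n\<in>interlacing k m. n j = m j}. f n)"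
      unfolding I1 using True zero by (intro sum.mono_neutral_right) (auto intro!: finite_subset[OF _ fK])
    also have "\<dots> = (\<Sum>n\<in>{n\<in>interlacing k m. n j = m j}.
        (real (x k) - real (m j)) * (row_weight (x k) k m n * interlacing_sum x k n))"
      by (intro sum.cong) (auto simp: fI)
    also have "\<dots> = (real (x k) - real (m j)) * facet x k m j (m j)"
      unfolding interlacing_def facet_def sum_distrib_left[symmetric]
      using True assms(1)[OF True] by (subst sum_PiE_fixed) auto
    finally show ?thesis using True by simp
  qed auto
  have t3: "(\<Sum>n\<in>{n\<in>K. 0 < j \<and> n (j - 1) = m j}. f n) =
     (if 0 < j then facet x k m (j - 1) (m j) else 0)"
  proof (cases j)
    case (Suc i)
    have "m i < m j" using assms Suc by auto
    have "(\<Sum>n\<in>{n\<in>K. 0 < j \<and> n (j - 1) = m j}. f n) =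
        (\<Sum>n\<in>{n\<in>K. n i = m j}. row_weight (x k) k m n * interlacing_sum x k n)"
      unfolding f_def using Suc assms(2) by (intro sum.cong) (auto simp: row_weight_incr_edge)
    also have "\<dots> = (\<Sum>n\<in>Pi\<^sub>E ({..<k} - {i}) B'.
        row_weight (x k) k m (n(i := m j)) * interlacing_sum x k (n(i := m j)))"
      unfolding K_def
      by (rule sum_PiE_fixed) (use Suc assms(2) \<open>m i < m j\<close> in \<open>auto simp: B'_def B_def\<close>)
    also have "Pi\<^sub>E ({..<k} - {i}) B' = Pi\<^sub>E ({..<k} - {i}) B"
      using Suc by (intro PiE_cong) (auto simp: B'_def)
    finally show ?thesis using Suc by (simp add: facet_def B_def del: fun_upd_apply)
  qed simp
  show ?thesis using s1 s2 t0 t1 t2 t3 by simp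
qed

text \<open>The Pieri rule. The faces left over by \<open>interlacing_sum_incr\<close> are those produced by
  \<open>telescope_interlacing\<close>, which turns them back into shifts of the shorter sequences. These are known by
  induction.\<close>

lemma interlacing_sum_recurrence:
  assumes "\<And>i. Suc i < k \<Longrightarrow> m i < m (Suc i)"
  shows "(\<Sum>j<k. interlacing_sum x k (incr m j)) =
     ((\<Sum>i<k. real (x i)) - (\<Sum>i<k. real (m i))) * interlacing_sum x k m"
  using assms
proof (induction k arbitrary: m)
  case (Suc k)
  have mono: "m i < m (Suc i)" if "i < k" for i using Suc.prems that by simp
  define p where "p = real (x k)"
  define A where "A j = (p - real (m j)) * facet x k m j (m j)" for j
  define C where "C j = facet x k m j (m (Suc j))" for j
  define I where "I = interlacing_sum x (Suc k) m"
  have "(\<Sum>j<Suc k. interlacing_sum x (Suc k) (incr m j)) =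
    (\<Sum>j<Suc k. (p - real (m j)) * I - (if j < k then A j else 0) +
        (if 0 < j then facet x k m (j - 1) (m j) else 0))"
    using mono by (intro sum.cong refl) (simp add: interlacing_sum_incr p_def A_def I_def del: interlacing_sum.simps)
  also have "\<dots> = (\<Sum>j<Suc k. p - real (m j)) * I - (\<Sum>j<Suc k. if j < k then A j else 0)
     + (\<Sum>j<Suc k. if 0 < j then facet x k m (j - 1) (m j) else 0)"
    by (simp only: sum.distrib sum_subtractf[of "\<lambda>j. (p - real (m j)) * I"] sum_distrib_right)
  also have "(\<Sum>j<Suc k. if j < k then A j else 0) = (\<Sum>j<k. A j)" by simp
  also have "(\<Sum>j<Suc k. if 0 < j then facet x k m (j - 1) (m j) else 0) = (\<Sum>j<k. C j)"
    by (subst sum.lessThan_Suc_shift) (simp add: C_def)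
  finally have 1: "(\<Sum>j<Suc k. interlacing_sum x (Suc k) (incr m j)) =
    (\<Sum>j<Suc k. p - real (m j)) * I - (\<Sum>j<k. A j - C j)"
    unfolding sum_subtractf[of A] by linarith
  have "(\<Sum>j<k. A j - C j) = (\<Sum>j<k. \<Sum>n\<in>interlacing k m. row_weight (x k) k m n *
      ((p - real (n j)) * interlacing_sum x k n - interlacing_sum x k (incr n j)))"
    using mono by (intro sum.cong refl) (simp add: telescope_interlacing p_def A_def C_def)
  also have "\<dots> = (\<Sum>n\<in>interlacing k m. row_weight (x k) k m n *
      ((\<Sum>j<k. p - real (n j)) * interlacing_sum x k n - (\<Sum>j<k. interlacing_sum x k (incr n j))))"
    by (subst sum.swap)
       (simp only: sum_distrib_left sum_distrib_right right_diff_distrib left_diff_distrib sum_subtractf)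
  also have "\<dots> = (\<Sum>n\<in>interlacing k m. row_weight (x k) k m n *
      ((real k * p - (\<Sum>i<k. real (x i))) * interlacing_sum x k n))"
  proof (intro sum.cong refl)
    fix n assume "n \<in> interlacing k m"
    then have "(\<Sum>j<k. interlacing_sum x k (incr n j)) = ((\<Sum>i<k. real (x i)) - (\<Sum>i<k. real (n i))) * interlacing_sum x k n"
      by (intro Suc.IH interlacing_strict)
    then show "row_weight (x k) k m n *
      ((\<Sum>j<k. p - real (n j)) * interlacing_sum x k n - (\<Sum>j<k. interlacing_sum x k (incr n j))) =
      row_weight (x k) k m n * ((real k * p - (\<Sum>i<k. real (x i))) * interlacing_sum x k n)"
      by (simp add: sum_subtractf algebra_simps)
  qed
  also have "\<dots> = (real k * p - (\<Sum>i<k. real (x i))) * I"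
    by (simp add: I_def sum_distrib_left mult_ac)
  finally show ?case unfolding 1 I_def[symmetric]
    by (simp add: sum_subtractf p_def algebra_simps)
qed simp

section \<open>Lozenge tilings row by row\<close>

text \<open>The three types of lozenges correspond to the three directions of the edge that the two triangles share.\<close>

lemma lozenge_iff:
  "lozenge r \<longleftrightarrow> (\<exists>a b. r = {Up (a, b), Down (a, b)} \<or> r = {Up (a, b), Down (a + 1, b)} \<or>
     r = {Up (a, b), Down (a + 1, b - 1)})" (is "_ = ?R")
proof
  assume "lozenge r"
  then obtain s t where st: "r = {s, t}" "s \<noteq> t" "card (verts s \<inter> verts t) = 2"
    unfolding lozenge_def by blast
  obtain a b where "verts s \<inter> verts t = hedge a b \<or> verts s \<inter> verts t = nedge a b \<or>
      verts s \<inter> verts t = wedge a b"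
    using edge_cases[OF st(3) inf_le1] by blast
  then consider "hedge a b \<subseteq> verts s" "hedge a b \<subseteq> verts t" | "nedge a b \<subseteq> verts s" "nedge a b \<subseteq> verts t"
    | "wedge a b \<subseteq> verts s" "wedge a b \<subseteq> verts t"
    by (metis inf_le1 inf_le2)
  then show ?R
  proof cases
    case 1
    then have "r = {Up (a, b), Down (a + 1, b - 1)}"
      using st(1,2) unfolding hedge_subset by blast
    then show ?thesis by blast
  next
    case 2
    then have "r = {Up (a, b), Down (a, b)}"
      using st(1,2) unfolding nedge_subset by blast
    then show ?thesis by blast
  next
    case 3
    then have "r = {Up (a - 1, b), Down (a, b)}"
      using st(1,2) unfolding wedge_subset by blast
    then have "r = {Up (a - 1, b), Down (a - 1 + 1, b)}" by simp
    then show ?thesis by blast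
  qed
next
  have "verts (Up (a, b)) \<inter> verts (Down (a, b)) = nedge a b"
    "verts (Up (a, b)) \<inter> verts (Down (a + 1, b)) = wedge (a + 1) b"
    "verts (Up (a, b)) \<inter> verts (Down (a + 1, b - 1)) = hedge a b" for a b
    by (auto simp: edge_defs)
  then have c: "card (verts (Up (a, b)) \<inter> verts (Down (a, b))) = 2"
    "card (verts (Up (a, b)) \<inter> verts (Down (a + 1, b))) = 2"
    "card (verts (Up (a, b)) \<inter> verts (Down (a + 1, b - 1))) = 2" for a b
    by (simp_all only: card_edge)
  have "lozenge {Up p, Down q}" if "card (verts (Up p) \<inter> verts (Down q)) = 2" for p q
    unfolding lozenge_def using that by (intro exI[of _ "Up p"] exI[of _ "Down q"] conjI) simp_all
  then show "lozenge r" if ?R using that c by metis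
qed

lemma nw_se_iff: "nw_se r \<longleftrightarrow> (\<exists>a b. r = {Up (a, b), Down (a, b)})"
proof
  assume "nw_se r"
  then obtain p where r: "lozenge r" "p \<in> lozenge_verts r" "p + (- E + NW) \<in> lozenge_verts r"
    unfolding nw_se_def by auto
  obtain u v where p: "p = (u, v)" by (cases p)
  from r(1) obtain a b where "r = {Up (a, b), Down (a, b)} \<or> r = {Up (a, b), Down (a + 1, b)} \<or>
     r = {Up (a, b), Down (a + 1, b - 1)}"
    unfolding lozenge_iff by blast
  moreover have "r \<noteq> {Up (a, b), Down (a + 1, b)}" "r \<noteq> {Up (a, b), Down (a + 1, b - 1)}"
    using r(2,3) unfolding p by (auto simp: lozenge_verts_def)
  ultimately show "\<exists>a b. r = {Up (a, b), Down (a, b)}" by blast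
next
  assume "\<exists>a b. r = {Up (a, b), Down (a, b)}"
  then obtain a b where r: "r = {Up (a, b), Down (a, b)}" by blast
  then have "(a + 1, b) \<in> lozenge_verts r" "(a + 1, b) + (- E + NW) \<in> lozenge_verts r"
    by (auto simp: lozenge_verts_def)
  then show "nw_se r" unfolding nw_se_def using lozenge_iff r by blast
qed

text \<open>Triangles are numbered within their row from the left boundary, which moves one step to the left from each
  row to the next. In these coordinates \<open>down c j\<close> has the neighbours \<open>up c j\<close> on its right, \<open>up (c - 1) j\<close> on its
  left and \<open>up c (Suc j)\<close> above it.\<close>

definition up :: "nat \<Rightarrow> nat \<Rightarrow> triangle" where "up c j = Up (int c - int j, int j)"
definition down :: "nat \<Rightarrow> nat \<Rightarrow> triangle" where "down c j = Down (int c - int j, int j)"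

lemma up_down_simps [simp]:
  "up c j = up c' j' \<longleftrightarrow> c = c' \<and> j = j'" "down c j = down c' j' \<longleftrightarrow> c = c' \<and> j = j'"
  "up c j \<noteq> down c' j'" "down c' j' \<noteq> up c j"
  by (auto simp: up_def down_def)

text \<open>As a tiling is built up row by row, the peaks above the \<open>k\<close> rows are allowed at arbitrary positions \<open>m\<close>.\<close>

definition region :: "(nat \<Rightarrow> nat) \<Rightarrow> nat \<Rightarrow> (nat \<Rightarrow> nat) \<Rightarrow> triangle set" where
  "region x k m = {up c j | c j. j < k \<and> c < x j} \<union> {down c j | c j. j < k \<and> c \<le> x j} \<union>
     {up (m i) k | i. i < k}"

text \<open>The left neighbour is given by its lattice point, since for \<open>c = 0\<close> it lies outside the numbered part of the
  row.\<close>

lemma lozenge_down: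
  assumes "lozenge r" "down c j \<in> r"
  shows "r = {up c j, down c j} \<or> r = {up c (Suc j), down c j} \<or>
    r = {Up (int c - 1 - int j, int j), down c j}"
proof -
  obtain a b where "r = {Up (a, b), Down (a, b)} \<or> r = {Up (a, b), Down (a + 1, b)} \<or>
     r = {Up (a, b), Down (a + 1, b - 1)}" using assms(1) unfolding lozenge_iff by blast
  then show ?thesis using assms(2) unfolding up_def down_def by fastforce
qed

lemma lozenges [simp]: "lozenge {up c j, down c j}" "lozenge {up c (Suc j), down c j}"
  "lozenge {up c j, down (Suc c) j}"
proof -
  have "lozenge {Up (a, b), Down (a, b)}" "lozenge {Up (a, b), Down (a + 1, b)}"
    "lozenge {Up (a, b), Down (a + 1, b - 1)}" for a b
    using lozenge_iff by blast+
  from this(1)[of "int c - int j" "int j"] this(3)[of "int c - int (Suc j)" "int (Suc j)"]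
    this(2)[of "int c - int j" "int j"]
  show "lozenge {up c j, down c j}" "lozenge {up c (Suc j), down c j}" "lozenge {up c j, down (Suc c) j}"
    by (simp_all add: up_def down_def algebra_simps)
qed

lemma nw_se_simps [simp]: "nw_se {up c j, down c j}" "\<not> nw_se {up c (Suc j), down c j}"
  "\<not> nw_se {up c j, down (Suc c) j}"
  by (auto simp: nw_se_iff up_def down_def doubleton_eq_iff)

lemma partition_on_unique:
  assumes "partition_on R T" "r \<in> T" "s \<in> T" "t \<in> r" "t \<in> s"
  shows "r = s"
  using assms by (auto simp: partition_on_def disjoint_def)

text \<open>In a row with peaks at \<open>m\<close> and unpaired upward triangles at \<open>n\<close>, the numbers \<open>c\<close> for which
  \<open>up c\<close> and \<open>down c\<close> are paired: all \<open>c\<close> left of the first peak, and between two peaks those on the right of the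
  unpaired triangle.\<close>

definition nw_slots :: "nat \<Rightarrow> (nat \<Rightarrow> nat) \<Rightarrow> (nat \<Rightarrow> nat) \<Rightarrow> nat set" where
  "nw_slots k m n = {..<m 0} \<union> (\<Union>j<k. {Suc (n j)..<m (Suc j)})"

lemma block_cases:
  fixes m :: "nat \<Rightarrow> nat"
  obtains "c < m 0" | j where "j < k" "m j \<le> c" "c < m (Suc j)" | "m k \<le> c"
proof -
  have "c < m 0 \<or> (\<exists>j<k. m j \<le> c \<and> c < m (Suc j)) \<or> m k \<le> c"
  proof (induction k)
    case (Suc k)
    then show ?case by (metis less_Suc_eq not_less)
  qed auto
  then show ?thesis using that by blast
qed

lemma less_upto:
  assumes "\<And>i. i < k \<Longrightarrow> m i < (m (Suc i) :: nat)" "i < j" "j \<le> k"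
  shows "m i < m j"
  using assms(2,3)
proof (induction j)
  case (Suc j)
  have "m j < m (Suc j)" using assms(1) Suc.prems by simp
  moreover have "i = j \<or> m i < m j" using Suc by (metis Suc_leD less_antisym)
  ultimately show ?case by auto
qed simp

text \<open>The top row of a region with \<open>k + 1\<close> rows whose peaks all stand on downward triangles of that row.\<close>

locale tiling_row =
  fixes x :: "nat \<Rightarrow> nat" and k :: nat and m :: "nat \<Rightarrow> nat"
  assumes strict: "\<And>i. i < k \<Longrightarrow> m i < m (Suc i)"
    and bound: "m k \<le> x k"
begin

abbreviation "X \<equiv> x k"

lemma m_le: "i \<le> j \<Longrightarrow> j \<le> k \<Longrightarrow> m i \<le> m j"
  using less_upto[of k m i j] strict by (cases "i = j") auto

lemma m_in_block:
  assumes "i \<le> k" "j < k" "m j \<le> m i" "m i < m (Suc j)" shows "i = j"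
proof (rule ccontr)
  assume "i \<noteq> j"
  then consider "i < j" | "Suc j \<le> i" by linarith
  then show False
  proof cases
    case 1
    then show ?thesis using less_upto[of k m i j] strict assms by auto
  next
    case 2
    then show ?thesis using m_le[of "Suc j" i] assms by auto
  qed
qed

text \<open>Here \<open>g c\<close> says that \<open>down c\<close> is paired with \<open>up c\<close>, and \<open>l c\<close> that \<open>down (c + 1)\<close> is paired with
  \<open>up c\<close>. If \<open>g c\<close> holds, \<open>up c\<close> is not available to the next downward triangle, so \<open>g\<close> propagates to
  the right until the next peak. For the same reason \<open>l\<close> propagates to the left until the previous peak. Left of the first
  peak \<open>g\<close> is forced by the left boundary, and right of the last peak \<open>l\<close> is forced by the right one. Between two
  peaks, \<open>l\<close> holds up to some point and \<open>g\<close> from the next one on, with one unpaired upward triangle in between.\<close>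

lemma slots_of_matching:
  assumes gl: "\<And>c. c \<le> X \<Longrightarrow> c \<notin> m ` {..k} \<Longrightarrow> g c \<or> (\<exists>c'. c = Suc c' \<and> l c')"
    and g: "\<And>c. g c \<Longrightarrow> c < X \<and> c \<notin> m ` {..k} \<and> \<not> l c"
    and l: "\<And>c. l c \<Longrightarrow> c < X \<and> Suc c \<notin> m ` {..k} \<and> \<not> g (Suc c)"
  obtains n where "n \<in> interlacing k m" "Collect g = nw_slots k m n"
    "Collect l = {..<X} - nw_slots k m n - n ` {..<k}"
proof -
  define n where "n = (\<lambda>j\<in>{..<k}. LEAST c. m j \<le> c \<and> \<not> l c)"
  have n: "m j \<le> n j" "n j < m (Suc j)" "\<not> l (n j)" "\<And>c. m j \<le> c \<Longrightarrow> c < n j \<Longrightarrow> l c" if j: "j < k" for j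
  proof -
    have "m j < m (Suc j)" using strict j by simp
    define e where "e = m (Suc j) - 1"
    have "Suc e \<in> m ` {..k}" using j \<open>m j < m (Suc j)\<close> by (simp add: e_def)
    then have "\<not> l e" using l by blast
    moreover have "m j \<le> e" "e < m (Suc j)" using \<open>m j < m (Suc j)\<close> by (auto simp: e_def)
    ultimately have L: "m j \<le> n j \<and> \<not> l (n j)" "n j \<le> e"
      using j LeastI[of "\<lambda>c. m j \<le> c \<and> \<not> l c" e] Least_le[of "\<lambda>c. m j \<le> c \<and> \<not> l c" e]
      by (auto simp: n_def)
    then show "m j \<le> n j" "n j < m (Suc j)" "\<not> l (n j)" using \<open>e < _\<close> by auto
    show "l c" if "m j \<le> c" "c < n j" for c
      using not_less_Least[of c "\<lambda>c. m j \<le> c \<and> \<not> l c"] that j by (auto simp: n_def)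
  qed
  have first: "g c" if "c < m 0" for c
    using that
  proof (induction c)
    case 0
    then have "0 \<notin> m ` {..k}" using m_le[of 0] by force
    then show ?case using gl[of 0] by auto
  next
    case (Suc c)
    then have "g c" by simp
    have "Suc c \<notin> m ` {..k}" using m_le[of 0] Suc.prems by force
    moreover have "Suc c \<le> X" using Suc.prems m_le[of 0 k] bound by auto
    ultimately show ?case using gl[of "Suc c"] g[OF \<open>g c\<close>] by auto
  qed
  have mid: "g c" if j: "j < k" and "n j < c" "c < m (Suc j)" for c j
    using that(2,3)
  proof (induction c)
    case (Suc c)
    have "\<not> l c" using Suc n(3)[OF j] g by (cases "c = n j") auto
    moreover have "Suc c \<notin> m ` {..k}"
      using m_in_block[of _ j] Suc.prems n[OF j] j by force
    moreover have "Suc c \<le> X" using Suc.prems m_le[of "Suc j" k] bound j by auto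
    ultimately show ?case using gl[of "Suc c"] by auto
  qed simp
  have last: "l c" if "m k \<le> c" "c < X" for c
  proof -
    have "m k \<le> X - Suc i \<longrightarrow> l (X - Suc i)" if "i < X" for i
      using that
    proof (induction i)
      case (0)
      then have "X \<notin> m ` {..k}" if "m k \<le> X - Suc 0" using that m_le[of _ k] by force
      then show ?case using gl[of X] g[of X] 0 by auto
    next
      case (Suc i)
      define e where "e = X - Suc (Suc i)"
      have e: "X - Suc i = Suc e" using Suc.prems by (auto simp: e_def)
      have "l e" if "m k \<le> e"
      proof -
        have "l (Suc e)" using Suc that e by auto
        then have "\<not> g (Suc e)" using g by blast
        moreover have "Suc e \<notin> m ` {..k}" using m_le[of _ k] that by force
        moreover have "Suc e \<le> X" using e by auto
        ultimately show ?thesis using gl[of "Suc e"] by auto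
      qed
      then show ?case by (simp add: e_def)
    qed
    from this[of "X - Suc c"] show ?thesis using that by auto
  qed
  have "n \<in> interlacing k m"
    using n by (auto simp: interlacing_def PiE_iff extensional_def n_def)
  moreover have "g c \<longleftrightarrow> c \<in> nw_slots k m n" for c
  proof (rule iffI)
    assume gc: "g c"
    then have c: "c < X" "c \<notin> m ` {..k}" "\<not> l c" using g by auto
    consider "c < m 0" | j where "j < k" "m j \<le> c" "c < m (Suc j)" | "m k \<le> c"
      by (rule block_cases)
    then show "c \<in> nw_slots k m n"
    proof cases
      case (2 j)
      have "c \<noteq> n j"
      proof
        assume "c = n j"
        show False
        proof (cases "c = m j")
          case True
          then show ?thesis using c 2 by auto
        next
          case False
          then obtain e where "c = Suc e" "m j \<le> e" using 2 by (metis le_antisym not_less_eq_eq old.nat.exhaust less_eq_Suc_le le_0_eq)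
          then have "l e" using n(4)[OF 2(1)] \<open>c = n j\<close> by auto
          then show False using l gc \<open>c = Suc e\<close> by blast
        qed
      qed
      moreover have "\<not> c < n j" using n(4)[OF 2(1)] 2 c by blast
      ultimately show ?thesis using 2 by (auto simp: nw_slots_def)
    next
      case 3
      then show ?thesis using last c by auto
    qed (auto simp: nw_slots_def)
  next
    assume "c \<in> nw_slots k m n"
    then show "g c" unfolding nw_slots_def using first mid by auto
  qed
  moreover have "l c \<longleftrightarrow> c \<in> {..<X} - nw_slots k m n - n ` {..<k}" for c
  proof (rule iffI)
    assume "l c"
    then show "c \<in> {..<X} - nw_slots k m n - n ` {..<k}"
      using l n(3) \<open>\<And>c. g c \<longleftrightarrow> c \<in> nw_slots k m n\<close> g by fastforce
  next
    assume c: "c \<in> {..<X} - nw_slots k m n - n ` {..<k}"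
    consider "c < m 0" | j where "j < k" "m j \<le> c" "c < m (Suc j)" | "m k \<le> c"
      by (rule block_cases)
    then show "l c"
    proof cases
      case 1
      then show ?thesis using c by (auto simp: nw_slots_def)
    next
      case (2 j)
      then have "c \<noteq> n j" "c \<notin> {Suc (n j)..<m (Suc j)}" using c by (auto simp: nw_slots_def)
      then show ?thesis using n(4)[OF 2(1)] 2 by auto
    next
      case 3
      then show ?thesis using last c by auto
    qed
  qed
  ultimately show ?thesis using that by blast
qed

end

lemma region_iff [simp]:
  "up c j \<in> region x k m \<longleftrightarrow> (j < k \<and> c < x j) \<or> (j = k \<and> c \<in> m ` {..<k})"
  "down c j \<in> region x k m \<longleftrightarrow> j < k \<and> c \<le> x j"
  by (auto simp: region_def)

lemma region_cases:
  assumes "t \<in> region x k m"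
  obtains c j where "t = up c j" | c j where "t = down c j"
  using assms by (auto simp: region_def)

lemma lozenge_down_region:
  assumes "lozenge r" "r \<subseteq> region x k m" "down c j \<in> r"
  shows "r = {up c j, down c j} \<or> r = {up c (Suc j), down c j} \<or> (\<exists>c'. c = Suc c' \<and> r = {up c' j, down c j})"
proof -
  have "\<exists>c'. c = Suc c' \<and> r = {up c' j, down c j}" if "r = {Up (int c - 1 - int j, int j), down c j}"
  proof -
    have "Up (int c - 1 - int j, int j) \<in> region x k m" using that assms(2) by auto
    then obtain c' j' where "Up (int c - 1 - int j, int j) = up c' j'"
      by (rule region_cases) (auto simp: down_def)
    then have "Up (int c - 1 - int j, int j) = up c' j" "c = Suc c'" by (auto simp: up_def)
    then show ?thesis using that by auto
  qed
  then show ?thesis using lozenge_down[OF assms(1,3)] by blast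
qed

lemma lozenge_has_down:
  assumes "lozenge r" "r \<subseteq> region x k m"
  obtains c j where "down c j \<in> r"
proof -
  obtain p where p: "Down p \<in> r" using assms(1) unfolding lozenge_iff by blast
  then have "Down p \<in> region x k m" using assms(2) by auto
  then obtain c j where "Down p = down c j" by (rule region_cases) (auto simp: up_def)
  then show ?thesis using that p by metis
qed

lemma finite_region: "finite (region x k m)"
proof -
  have "region x k m \<subseteq> (\<Union>j<k. (\<lambda>c. up c j) ` {..<x j}) \<union> (\<Union>j<k. (\<lambda>c. down c j) ` {..x j}) \<union>
     (\<lambda>i. up (m i) k) ` {..<k}"
    by (auto simp: region_def)
  then show ?thesis by (rule finite_subset) auto
qed

lemma finite_tilings: "finite R \<Longrightarrow> finite (tilings R)"
  by (rule finite_subset[of _ "Pow (Pow R)"]) (auto simp: tilings_def partition_on_def)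

lemma tiling_subset: "T \<in> tilings R \<Longrightarrow> r \<in> T \<Longrightarrow> r \<subseteq> R"
  by (auto simp: tilings_def partition_on_def)

lemma tiling_Union: "T \<in> tilings R \<Longrightarrow> \<Union>T = R"
  by (simp add: tilings_def partition_on_def)

lemma tiling_lozenge: "T \<in> tilings R \<Longrightarrow> r \<in> T \<Longrightarrow> lozenge r"
  by (auto simp: tilings_def)

lemma tiling_cover: "T \<in> tilings R \<Longrightarrow> t \<in> R \<Longrightarrow> \<exists>r\<in>T. t \<in> r"
  by (auto simp: tilings_def partition_on_def)

lemma tilingsI:
  assumes "\<And>r. r \<in> T \<Longrightarrow> lozenge r" "\<Union>T = R" "\<And>r s t. r \<in> T \<Longrightarrow> s \<in> T \<Longrightarrow> t \<in> r \<Longrightarrow> t \<in> s \<Longrightarrow> r = s"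
  shows "T \<in> tilings R"
proof -
  have "{} \<notin> T" using assms(1) unfolding lozenge_def by blast
  then show ?thesis using assms unfolding tilings_def partition_on_def disjoint_def by blast
qed

lemma tiling_unique: "T \<in> tilings R \<Longrightarrow> r \<in> T \<Longrightarrow> s \<in> T \<Longrightarrow> t \<in> r \<Longrightarrow> t \<in> s \<Longrightarrow> r = s"
  unfolding tilings_def mem_Collect_eq by (metis partition_on_unique)

lemma tiling_union:
  assumes "T \<in> tilings R" "T' \<in> tilings R'" "R \<inter> R' = {}"
  shows "T \<union> T' \<in> tilings (R \<union> R')"
proof (rule tilingsI)
  show "lozenge r" if "r \<in> T \<union> T'" for r
    using that assms tiling_lozenge by blast
  show "\<Union> (T \<union> T') = R \<union> R'"
    using assms by (auto simp: tilings_def partition_on_def)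
  show "r = s" if "r \<in> T \<union> T'" "s \<in> T \<union> T'" "t \<in> r" "t \<in> s" for r s t
    using that tiling_unique[OF assms(1)] tiling_unique[OF assms(2)]
      tiling_subset[OF assms(1)] tiling_subset[OF assms(2)] assms(3) by blast
qed

lemma tiling_diff:
  assumes "T \<in> tilings R" "A \<subseteq> T"
  shows "T - A \<in> tilings (R - \<Union>A)"
proof (rule tilingsI)
  show "lozenge r" if "r \<in> T - A" for r
    using that assms tiling_lozenge by blast
  show "\<Union> (T - A) = R - \<Union>A"
    using tiling_subset[OF assms(1)] tiling_cover[OF assms(1)] tiling_unique[OF assms(1)] assms(2) by blast
  show "r = s" if "r \<in> T - A" "s \<in> T - A" "t \<in> r" "t \<in> s" for r s t
    using that tiling_unique[OF assms(1)] by blast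
qed

lemma tilings_disjoint:
  assumes "T \<in> tilings R" "T' \<in> tilings R'" "R \<inter> R' = {}"
  shows "T \<inter> T' = {}"
proof (rule ccontr)
  assume "T \<inter> T' \<noteq> {}"
  then obtain r where r: "r \<in> T" "r \<in> T'" by blast
  obtain t where "t \<in> r" using tiling_lozenge[OF assms(1) r(1)] unfolding lozenge_def by blast
  then show False using tiling_subset[OF assms(1) r(1)] tiling_subset[OF assms(2) r(2)] assms(3) by blast
qed

context tiling_row begin

text \<open>The remaining upward triangles of the row, which are paired with the downward triangle on their right.\<close>

definition ne_slots :: "(nat \<Rightarrow> nat) \<Rightarrow> nat set" where
  "ne_slots n = {..<X} - nw_slots k m n - n ` {..<k}"

definition row_tiling :: "(nat \<Rightarrow> nat) \<Rightarrow> triangle set set" where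
  "row_tiling n = (\<lambda>c. {up c (Suc k), down c k}) ` (m ` {..k}) \<union>
     (\<lambda>c. {up c k, down c k}) ` nw_slots k m n \<union> (\<lambda>c. {up c k, down (Suc c) k}) ` ne_slots n"

context
  fixes n assumes n: "n \<in> interlacing k m"
begin

lemma leftover_bounds: "j < k \<Longrightarrow> m j \<le> n j" "j < k \<Longrightarrow> n j < m (Suc j)"
  using n by (auto simp: interlacing_def PiE_iff)

lemma same_block:
  assumes "i < k" "j < k" "m i \<le> c" "c < m (Suc i)" "m j \<le> c" "c < m (Suc j)"
  shows "i = j"
proof (rule ccontr)
  assume "i \<noteq> j"
  then consider "Suc i \<le> j" | "Suc j \<le> i" by linarith
  then show False using m_le[of "Suc i" j] m_le[of "Suc j" i] assms by cases auto
qed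

lemma nw_slots_inner:
  assumes "j < k" "m j \<le> c" "c < m (Suc j)"
  shows "c \<in> nw_slots k m n \<longleftrightarrow> n j < c"
proof
  assume "c \<in> nw_slots k m n"
  moreover have "\<not> c < m 0" using m_le[of 0 j] assms by auto
  ultimately obtain i where i: "i < k" "n i < c" "c < m (Suc i)" by (auto simp: nw_slots_def)
  then have "i = j" using same_block[of i j c] leftover_bounds[of i] assms by auto
  then show "n j < c" using i by simp
qed (use assms in \<open>auto simp: nw_slots_def\<close>)

lemma nw_slots_first: "c < m 0 \<Longrightarrow> c \<in> nw_slots k m n"
  by (auto simp: nw_slots_def)

lemma nw_slots_last: "c \<in> nw_slots k m n \<Longrightarrow> c < m k"
proof -
  assume "c \<in> nw_slots k m n"
  then consider "c < m 0" | i where "i < k" "n i < c" "c < m (Suc i)" by (auto simp: nw_slots_def)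
  then show ?thesis
  proof cases
    case 1
    then show ?thesis using m_le[of 0 k] by simp
  next
    case (2 i)
    then show ?thesis using m_le[of "Suc i" k] by simp
  qed
qed

lemma leftover_inner:
  assumes "j < k" "m j \<le> c" "c < m (Suc j)"
  shows "c \<in> n ` {..<k} \<longleftrightarrow> c = n j"
proof
  assume "c \<in> n ` {..<k}"
  then obtain i where i: "i < k" "c = n i" by auto
  then have "i = j" using same_block[OF i(1) assms(1) _ _ assms(2,3)] leftover_bounds[OF i(1)] by simp
  then show "c = n j" using i by simp
qed (use assms in auto)

lemma leftover_lt: "j < k \<Longrightarrow> n j < m k"
  using leftover_bounds[of j] m_le[of "Suc j" k] by simp

lemma m_notin_nw_slots: "i \<le> k \<Longrightarrow> m i \<notin> nw_slots k m n"
proof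
  assume i: "i \<le> k" "m i \<in> nw_slots k m n"
  then have "i < k" using nw_slots_last[of "m i"] by (cases "i = k") auto
  then show False using nw_slots_inner[of i "m i"] strict[of i] i leftover_bounds[of i] by auto
qed

lemma nw_slots_bound: "c \<in> nw_slots k m n \<Longrightarrow> c < X"
  using nw_slots_last[of c] bound by simp

lemma ne_slot_cases:
  assumes "c \<in> ne_slots n"
  obtains j where "j < k" "m j \<le> c" "c < n j" | "m k \<le> c" "c < X"
proof -
  consider "c < m 0" | j where "j < k" "m j \<le> c" "c < m (Suc j)" | "m k \<le> c" by (rule block_cases)
  then show ?thesis
  proof cases
    case 1
    then show ?thesis using nw_slots_first assms by (auto simp: ne_slots_def)
  next
    case (2 j)
    then have "c < n j" using nw_slots_inner[OF 2] leftover_inner[OF 2] assms by (auto simp: ne_slots_def)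
    then show ?thesis using that 2 by blast
  next
    case 3
    then show ?thesis using that assms by (auto simp: ne_slots_def)
  qed
qed

text \<open>Together with \<open>m_notin_nw_slots\<close> and \<open>ne_slots_cover\<close>, this says that the three kinds of lozenges of \<open>row_tiling\<close> use each downward triangle
  of the row at most once and at least once.\<close>

lemma ne_slot_Suc:
  assumes "c \<in> ne_slots n"
  shows "Suc c \<notin> m ` {..k}" "Suc c \<notin> nw_slots k m n"
proof -
  have "Suc c \<notin> m ` {..k} \<and> Suc c \<notin> nw_slots k m n" using assms
  proof (cases rule: ne_slot_cases)
    case (1 j)
    then have b: "j < k" "m j \<le> Suc c" "Suc c < m (Suc j)" using leftover_bounds[of j] by auto
    have "Suc c \<noteq> m i" if "i \<le> k" for i using m_in_block[of i j] b 1 that by auto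
    then show ?thesis using nw_slots_inner[OF b] 1 by auto
  next
    case 2
    then have "Suc c \<noteq> m i" if "i \<le> k" for i using m_le[of i k] that by auto
    then show ?thesis using nw_slots_last[of "Suc c"] 2 by auto
  qed
  then show "Suc c \<notin> m ` {..k}" "Suc c \<notin> nw_slots k m n" by auto
qed

lemma ne_slots_cover:
  assumes "c \<le> X" "c \<notin> m ` {..k}" "c \<notin> nw_slots k m n"
  obtains e where "c = Suc e" "e \<in> ne_slots n"
proof -
  have c0: "\<not> c < m 0" using nw_slots_first assms by blast
  moreover have "c \<noteq> m 0" using assms by auto
  ultimately obtain e where e: "c = Suc e" "m 0 \<le> e"
    by (cases c) auto
  consider "c < m 0" | j where "j < k" "m j \<le> c" "c < m (Suc j)" | "m k \<le> c" by (rule block_cases)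
  then have "e \<in> ne_slots n"
  proof cases
    case (2 j)
    then have "c \<noteq> m j" using assms by auto
    then have b: "j < k" "m j \<le> e" "e < m (Suc j)" using 2 e by auto
    have "\<not> n j < c" using nw_slots_inner[OF 2] assms by auto
    then show ?thesis using nw_slots_inner[OF b] leftover_inner[OF b] e assms by (auto simp: ne_slots_def)
  next
    case 3
    then have "m k \<le> e" using assms e by (metis atMost_iff imageI le_SucE order_refl)
    then show ?thesis using nw_slots_last[of e] leftover_lt e assms by (force simp: ne_slots_def)
  qed (use c0 in simp)
  then show ?thesis using e that by blast
qed

lemma row_tiling_cases:
  assumes "r \<in> row_tiling n"
  obtains c where "c \<in> m ` {..k}" "r = {up c (Suc k), down c k}"
    | c where "c \<in> nw_slots k m n" "r = {up c k, down c k}"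
    | c where "c \<in> ne_slots n" "r = {up c k, down (Suc c) k}"
  using assms unfolding row_tiling_def by blast

lemma row_tiling_up:
  assumes "r \<in> row_tiling n" "up c j \<in> r"
  shows "j = Suc k \<and> c \<in> m ` {..k} \<and> r = {up c (Suc k), down c k} \<or>
    j = k \<and> c \<in> nw_slots k m n \<and> r = {up c k, down c k} \<or> j = k \<and> c \<in> ne_slots n \<and> r = {up c k, down (Suc c) k}"
  using assms(1)
proof (cases rule: row_tiling_cases)
  case (1 e)
  then have "c = e" "j = Suc k" using assms(2) by simp_all
  then show ?thesis using 1 by blast
next
  case (2 e)
  then have "c = e" "j = k" using assms(2) by simp_all
  then show ?thesis using 2 by blast
next
  case (3 e)
  then have "c = e" "j = k" using assms(2) by simp_all
  then show ?thesis using 3 by blast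
qed

lemma row_tiling_down:
  assumes "r \<in> row_tiling n" "down c j \<in> r"
  shows "j = k \<and> (c \<in> m ` {..k} \<and> r = {up c (Suc k), down c k} \<or>
    c \<in> nw_slots k m n \<and> r = {up c k, down c k} \<or> (\<exists>e. c = Suc e \<and> e \<in> ne_slots n \<and> r = {up e k, down (Suc e) k}))"
  using assms(1)
proof (cases rule: row_tiling_cases)
  case (1 e)
  then have "c = e" "j = k" using assms(2) by simp_all
  then show ?thesis using 1 by blast
next
  case (2 e)
  then have "c = e" "j = k" using assms(2) by simp_all
  then show ?thesis using 2 by blast
next
  case (3 e)
  then have "c = Suc e" "j = k" using assms(2) by simp_all
  then show ?thesis using 3 by blast
qed

lemma row_tiling_triangle:
  assumes "r \<in> row_tiling n" "t \<in> r"
  shows "(\<exists>c j. t = up c j) \<or> (\<exists>c j. t = down c j)"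
  using assms(1) by (cases rule: row_tiling_cases) (use assms(2) in blast)+

lemma row_tiling_tilings:
  shows "row_tiling n \<in> tilings (region x (Suc k) m - region x k n)"
proof (rule tilingsI)
  show "lozenge r" if "r \<in> row_tiling n" for r
    using that by (auto simp: row_tiling_def)
  show "r = s" if rs: "r \<in> row_tiling n" "s \<in> row_tiling n" "t \<in> r" "t \<in> s" for r s t
  proof -
    consider c j where "t = up c j" | c j where "t = down c j"
      using row_tiling_triangle[OF rs(1,3)] by blast
    then show ?thesis
    proof cases
      case (1 c j)
      then show ?thesis using row_tiling_up[of r c j] row_tiling_up[of s c j] rs
        by (auto simp: ne_slots_def)
    next
      case (2 c j)
      have A: "c \<in> m ` {..k} \<Longrightarrow> c \<notin> nw_slots k m n" using m_notin_nw_slots by auto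
      have B: "c \<notin> m ` {..k} \<and> c \<notin> nw_slots k m n" if "c = Suc e" "e \<in> ne_slots n" for e
        using ne_slot_Suc[OF that(2)] that(1) by simp
      have tile: "q = (if c \<in> m ` {..k} then {up c (Suc k), down c k}
          else if c \<in> nw_slots k m n then {up c k, down c k} else {up (c - 1) k, down c k})"
        if q: "q \<in> row_tiling n" "down c j \<in> q" for q
      proof -
        consider "c \<in> m ` {..k}" "q = {up c (Suc k), down c k}" | "c \<in> nw_slots k m n" "q = {up c k, down c k}"
          | e where "c = Suc e" "e \<in> ne_slots n" "q = {up e k, down (Suc e) k}"
          using row_tiling_down[OF q] by blast
        then show ?thesis
        proof cases
          case 1
          then show ?thesis by simp
        next
          case 2
          then show ?thesis using A by meson
        next
          case (3 e)
          then show ?thesis using B[OF 3(1,2)] by simp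
        qed
      qed
      have "down c j \<in> r" "down c j \<in> s" using rs 2 by simp_all
      then show ?thesis using tile[OF rs(1)] tile[OF rs(2)] by (simp only:)
    qed
  qed
  show "\<Union> (row_tiling n) = region x (Suc k) m - region x k n"
  proof (intro set_eqI iffI)
    fix t assume "t \<in> \<Union> (row_tiling n)"
    then obtain r where r: "r \<in> row_tiling n" "t \<in> r" by blast
    have mX: "c \<le> X" if cm: "c \<in> m ` {..k}" for c
    proof -
      obtain i where "i \<le> k" "c = m i" using cm by auto
      then show ?thesis using m_le[of i k] bound by simp
    qed
    consider c j where "t = up c j" | c j where "t = down c j"
      using row_tiling_triangle[OF r] by blast
    then show "t \<in> region x (Suc k) m - region x k n"
    proof cases
      case (1 c j)
      have "c \<in> nw_slots k m n \<Longrightarrow> c \<notin> n ` {..<k}"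
      proof
        assume c: "c \<in> nw_slots k m n" "c \<in> n ` {..<k}"
        then obtain i where i: "i < k" "c = n i" by auto
        then show False using nw_slots_inner[of i c] leftover_bounds[of i] c by auto
      qed
      then show ?thesis using row_tiling_up[of r c j] r 1 nw_slots_bound[of c]
        by (auto simp: ne_slots_def)
    next
      case (2 c j)
      then show ?thesis using row_tiling_down[of r c j] r mX[of c] nw_slots_bound[of c]
        by (auto simp: ne_slots_def)
    qed
  next
    fix t assume t: "t \<in> region x (Suc k) m - region x k n"
    have "t \<in> region x (Suc k) m" using t by blast
    then consider c j where "t = up c j" | c j where "t = down c j"
      by (rule region_cases)
    then show "t \<in> \<Union> (row_tiling n)"
    proof cases
      case (1 c j)
      then consider "j = Suc k" "c \<in> m ` {..k}" | "j = k" "c < X" "c \<notin> n ` {..<k}"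
        using t by (auto simp: less_Suc_eq lessThan_Suc_atMost)
      then show ?thesis
      proof cases
        case 2
        then have "c \<in> nw_slots k m n \<or> c \<in> ne_slots n" by (auto simp: ne_slots_def)
        then show ?thesis using 1 2 by (auto simp: row_tiling_def)
      qed (use 1 in \<open>auto simp: row_tiling_def\<close>)
    next
      case (2 c j)
      then have "j = k" "c \<le> X" using t by (auto simp: less_Suc_eq)
      consider "c \<in> m ` {..k}" | "c \<in> nw_slots k m n" | e where "c = Suc e" "e \<in> ne_slots n"
        using ne_slots_cover[OF \<open>c \<le> X\<close>] by blast
      then show ?thesis
        using 2 \<open>j = k\<close> by cases (auto simp: row_tiling_def)
    qed
  qed
qed

text \<open>The weight of a row in the interlacing sum is the weight of the NW-SE lozenges of \<open>row_tiling\<close>.\<close>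

lemma row_weight_nw_slots: "row_weight p k m n = (\<Prod>c\<in>nw_slots k m n. real p - real c)"
proof -
  have d: "{Suc (n i)..<m (Suc i)} \<inter> {Suc (n j)..<m (Suc j)} = {}" if "i < k" "j < k" "i \<noteq> j" for i j
    using same_block[of i j] leftover_bounds[of i] leftover_bounds[of j] that by fastforce
  have d0: "{..<m 0} \<inter> (\<Union>j<k. {Suc (n j)..<m (Suc j)}) = {}"
  proof -
    have False if "c < m 0" "j < k" "n j < c" for c j
      using leftover_bounds(1)[OF that(2)] m_le[of 0 j] that by simp
    then show ?thesis by fastforce
  qed
  have "(\<Prod>c\<in>(\<Union>j<k. {Suc (n j)..<m (Suc j)}). real p - real c) =
      (\<Prod>j<k. \<Prod>c\<in>{Suc (n j)..<m (Suc j)}. real p - real c)"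
    using d by (intro prod.UNION_disjoint) auto
  then show ?thesis unfolding row_weight_def nw_slots_def
    using prod.union_disjoint[OF _ _ d0, of "\<lambda>c. real p - real c"] by simp
qed

end

lemma nw_slots_inj:
  assumes "n \<in> interlacing k m" "n' \<in> interlacing k m" "nw_slots k m n = nw_slots k m n'"
  shows "n = n'"
proof -
  have "n j = n' j" if j: "j < k" for j
    using nw_slots_inner[OF assms(1) j, of "n' j"] nw_slots_inner[OF assms(2) j, of "n j"]
      nw_slots_inner[OF assms(1) j, of "n j"] nw_slots_inner[OF assms(2) j, of "n' j"]
      leftover_bounds[OF assms(1) j] leftover_bounds[OF assms(2) j] assms(3) by force
  then show ?thesis using assms(1,2) unfolding interlacing_def by (intro PiE_ext) auto
qed

lemma region_subset:
  assumes "n \<in> interlacing k m"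
  shows "region x k n \<subseteq> region x (Suc k) m"
proof
  fix t assume t: "t \<in> region x k n"
  have nX: "c < X" if "c \<in> n ` {..<k}" for c using leftover_lt[OF assms] bound that by fastforce
  from t show "t \<in> region x (Suc k) m"
  proof (cases rule: region_cases)
    case (1 c j)
    then show ?thesis using t nX[of c] by auto
  next
    case (2 c j)
    then show ?thesis using t by simp
  qed
qed

text \<open>In a given tiling, each peak takes the downward triangle below it, and every other downward triangle of the top row
  is paired with one of its horizontal neighbours. So the top row satisfies the hypotheses of
  \<open>slots_of_matching\<close>.\<close>

lemma tiling_decompose:
  assumes T: "T \<in> tilings (region x (Suc k) m)"
  obtains n T' where "n \<in> interlacing k m" "T' \<in> tilings (region x k n)" "T = T' \<union> row_tiling n"
proof -
  define g where "g c \<longleftrightarrow> {up c k, down c k} \<in> T" for c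
  define l where "l c \<longleftrightarrow> {up c k, down (Suc c) k} \<in> T" for c
  note sub = tiling_subset[OF T] and loz = tiling_lozenge[OF T] and uniq = tiling_unique[OF T]
  have peak: "{up c (Suc k), down c k} \<in> T" if c: "c \<in> m ` {..k}" for c
  proof -
    obtain r where r: "r \<in> T" "up c (Suc k) \<in> r"
      using tiling_cover[OF T, of "up c (Suc k)"] c by (auto simp: lessThan_Suc_atMost)
    obtain c' j' where d: "down c' j' \<in> r" using lozenge_has_down[OF loz[OF r(1)] sub[OF r(1)]] by blast
    then have "j' < Suc k" using sub[OF r(1)] by auto
    then show ?thesis
      using lozenge_down_region[OF loz[OF r(1)] sub[OF r(1)] d] r by auto
  qed
  have gl: "g c \<or> (\<exists>c'. c = Suc c' \<and> l c')" if c: "c \<le> X" "c \<notin> m ` {..k}" for c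
  proof -
    obtain r where r: "r \<in> T" "down c k \<in> r"
      using tiling_cover[OF T, of "down c k"] c by auto
    have "up c (Suc k) \<notin> r" using sub[OF r(1)] c by (auto simp: lessThan_Suc_atMost)
    then show ?thesis
      using lozenge_down_region[OF loz[OF r(1)] sub[OF r(1)] r(2)] r(1)
      by (auto simp: g_def l_def)
  qed
  have g: "c < X \<and> c \<notin> m ` {..k} \<and> \<not> l c" if "g c" for c
  proof -
    have gT: "{up c k, down c k} \<in> T" using that by (simp add: g_def)
    have "c \<notin> m ` {..k}" using uniq[OF gT peak, of c "down c k"] by (auto simp: doubleton_eq_iff)
    moreover have "\<not> l c" using uniq[OF gT, of "{up c k, down (Suc c) k}" "up c k"]
      by (auto simp: l_def doubleton_eq_iff)
    moreover have "up c k \<in> region x (Suc k) m" using sub[OF gT] by simp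
    ultimately show ?thesis by auto
  qed
  have l: "c < X \<and> Suc c \<notin> m ` {..k} \<and> \<not> g (Suc c)" if "l c" for c
  proof -
    have lT: "{up c k, down (Suc c) k} \<in> T" using that by (simp add: l_def)
    have "Suc c \<notin> m ` {..k}" using uniq[OF lT peak, of "Suc c" "down (Suc c) k"] by (auto simp: doubleton_eq_iff)
    moreover have "\<not> g (Suc c)" using uniq[OF lT, of "{up (Suc c) k, down (Suc c) k}" "down (Suc c) k"]
      by (auto simp: g_def doubleton_eq_iff)
    moreover have "up c k \<in> region x (Suc k) m" using sub[OF lT] by simp
    ultimately show ?thesis by auto
  qed
  obtain n where n: "n \<in> interlacing k m" "Collect g = nw_slots k m n"
    "Collect l = {..<X} - nw_slots k m n - n ` {..<k}"
    using slots_of_matching[of g l] gl g l by blast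
  have "g c" if "c \<in> nw_slots k m n" for c using n(2) that by blast
  moreover have "l c" if "c \<in> ne_slots n" for c using n(3) that unfolding ne_slots_def by blast
  ultimately have RT: "row_tiling n \<subseteq> T"
    using peak unfolding row_tiling_def g_def l_def by blast
  have "region x (Suc k) m - \<Union> (row_tiling n) = region x k n"
    unfolding tiling_Union[OF row_tiling_tilings[OF n(1)]]
    by (rule double_diff[OF region_subset[OF n(1)] order_refl])
  then have "T - row_tiling n \<in> tilings (region x k n)"
    using tiling_diff[OF T RT] by simp
  moreover have "T = (T - row_tiling n) \<union> row_tiling n" using RT by blast
  ultimately show ?thesis using that n(1) by metis
qed

text \<open>Cutting off the top row: the peaks of the remaining region are the unpaired upward triangles of the row.\<close>

lemma tilings_row_step:
  shows "tilings (region x (Suc k) m) =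
    (\<Union>n\<in>interlacing k m. (\<lambda>T. T \<union> row_tiling n) ` tilings (region x k n))"
proof (intro set_eqI iffI)
  fix T assume "T \<in> tilings (region x (Suc k) m)"
  then obtain n T' where n: "n \<in> interlacing k m" and T': "T' \<in> tilings (region x k n)"
    and eq: "T = T' \<union> row_tiling n"
    by (rule tiling_decompose)
  show "T \<in> (\<Union>n\<in>interlacing k m. (\<lambda>T. T \<union> row_tiling n) ` tilings (region x k n))"
    unfolding eq by (rule UN_I[OF n]) (rule imageI[OF T'])
next
  fix T assume "T \<in> (\<Union>n\<in>interlacing k m. (\<lambda>T. T \<union> row_tiling n) ` tilings (region x k n))"
  then obtain n T' where n: "n \<in> interlacing k m" "T' \<in> tilings (region x k n)" "T = T' \<union> row_tiling n" by blast
  have "T' \<union> row_tiling n \<in> tilings (region x k n \<union> (region x (Suc k) m - region x k n))"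
    by (rule tiling_union[OF n(2) row_tiling_tilings[OF n(1)] Diff_disjoint])
  then show "T \<in> tilings (region x (Suc k) m)" using region_subset[OF n(1)] n(3)
    by (simp add: Un_absorb1)
qed

lemma tiling_sum_step:
  assumes w: "\<And>c. c < X \<Longrightarrow> w {up c k, down c k} = real X - real c"
  shows "(\<Sum>T\<in>tilings (region x (Suc k) m). \<Prod>r\<in>{r\<in>T. nw_se r}. w r) =
    (\<Sum>n\<in>interlacing k m. row_weight X k m n * (\<Sum>T\<in>tilings (region x k n). \<Prod>r\<in>{r\<in>T. nw_se r}. w r))"
proof -
  define F where "F = (\<lambda>T. \<Prod>r\<in>{r\<in>T. nw_se r}. w r :: real)"
  note fin = finite_tilings[OF finite_region]
  have disj: "T \<inter> row_tiling n = {}" if "n \<in> interlacing k m" "T \<in> tilings (region x k n)" for n T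
    using tilings_disjoint[OF that(2) row_tiling_tilings[OF that(1)]] by blast
  have inj: "inj_on (\<lambda>T. T \<union> row_tiling n) (tilings (region x k n))" if "n \<in> interlacing k m" for n
    using disj[OF that] by (intro inj_onI) blast
  \<comment> \<open>the sequence \<open>n\<close> can be read off from the NW-SE lozenges of the top row\<close>
  have bl: "{c. {up c k, down c k} \<in> T \<union> row_tiling n} = nw_slots k m n"
    if "n \<in> interlacing k m" "T \<in> tilings (region x k n)" for n T
  proof -
    have "{up c k, down c k} \<notin> T" for c using tiling_subset[OF that(2), of "{up c k, down c k}"] by auto
    moreover have "{up c k, down c k} \<in> row_tiling n \<longleftrightarrow> c \<in> nw_slots k m n" for c
      by (auto simp: row_tiling_def doubleton_eq_iff)
    ultimately show ?thesis by auto
  qed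
  have dj: "(\<lambda>T. T \<union> row_tiling n) ` tilings (region x k n) \<inter>
      (\<lambda>T. T \<union> row_tiling n') ` tilings (region x k n') = {}"
    if nn': "n \<in> interlacing k m" "n' \<in> interlacing k m" "n \<noteq> n'" for n n'
  proof (rule ccontr)
    assume "\<not> ?thesis"
    then obtain T T' where T: "T \<in> tilings (region x k n)" "T' \<in> tilings (region x k n')"
      "T \<union> row_tiling n = T' \<union> row_tiling n'" by blast
    have "nw_slots k m n = nw_slots k m n'"
      using bl[OF nn'(1) T(1)] bl[OF nn'(2) T(2)] T(3) by simp
    then show False using nw_slots_inj[OF nn'(1,2)] nn'(3) by simp
  qed
  have F: "F (T \<union> row_tiling n) = row_weight X k m n * F T"
    if n: "n \<in> interlacing k m" and T: "T \<in> tilings (region x k n)" for n T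
  proof -
    have fT: "finite T" "finite (row_tiling n)"
      using T finite_elements[OF finite_region[of x k n], of T]
      by (simp_all add: tilings_def row_tiling_def ne_slots_def nw_slots_def)
    have "{r \<in> T \<union> row_tiling n. nw_se r} = {r\<in>T. nw_se r} \<union> (\<lambda>c. {up c k, down c k}) ` nw_slots k m n"
      by (auto simp: row_tiling_def)
    moreover have "{r\<in>T. nw_se r} \<inter> (\<lambda>c. {up c k, down c k}) ` nw_slots k m n = {}"
      using disj[OF n T] by (auto simp: row_tiling_def)
    ultimately have "F (T \<union> row_tiling n) = F T * (\<Prod>r\<in>(\<lambda>c. {up c k, down c k}) ` nw_slots k m n. w r)"
      unfolding F_def using fT by (simp add: prod.union_disjoint nw_slots_def)
    also have "(\<Prod>r\<in>(\<lambda>c. {up c k, down c k}) ` nw_slots k m n. w r) = (\<Prod>c\<in>nw_slots k m n. w {up c k, down c k})"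
      by (subst prod.reindex) (auto simp: inj_on_def doubleton_eq_iff)
    also have "\<dots> = row_weight X k m n"
      using nw_slots_bound[OF n] w by (simp add: row_weight_nw_slots[OF n])
    finally show ?thesis by simp
  qed
  have "(\<Sum>T\<in>tilings (region x (Suc k) m). F T) =
      (\<Sum>n\<in>interlacing k m. \<Sum>T\<in>(\<lambda>T. T \<union> row_tiling n) ` tilings (region x k n). F T)"
    unfolding tilings_row_step using dj fin by (intro sum.UNION_disjoint) auto
  also have "\<dots> = (\<Sum>n\<in>interlacing k m. \<Sum>T\<in>tilings (region x k n). F (T \<union> row_tiling n))"
    by (rule sum.cong[OF refl]) (simp add: sum.reindex[OF inj])
  also have "\<dots> = (\<Sum>n\<in>interlacing k m. row_weight X k m n * (\<Sum>T\<in>tilings (region x k n). F T))"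
    by (intro sum.cong refl) (simp add: F sum_distrib_left)
  finally show ?thesis by (simp add: F_def)
qed

end

text \<open>A peak to the right of all downward triangles of the top row has no partner.\<close>

lemma tilings_empty_peak:
  assumes "x k < m k"
  shows "tilings (region x (Suc k) m) = {}"
proof (rule ccontr)
  assume "tilings (region x (Suc k) m) \<noteq> {}"
  then obtain T where T: "T \<in> tilings (region x (Suc k) m)" by auto
  obtain r where r: "r \<in> T" "up (m k) (Suc k) \<in> r"
    using tiling_cover[OF T, of "up (m k) (Suc k)"] by auto
  note lr = tiling_lozenge[OF T r(1)] tiling_subset[OF T r(1)]
  obtain c j where d: "down c j \<in> r" using lozenge_has_down[OF lr] by blast
  then have "down c j \<in> region x (Suc k) m" using lr(2) by blast
  then have "j < Suc k" "c \<le> x j" by auto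
  then show False using lozenge_down_region[OF lr d] r assms by auto
qed

text \<open>Induction on the number of rows. If the last peak does not stand on the top row, there is no tiling, and the
  interlacing sum vanishes as well. This happens even if the region of the theorem has no such peak, because the
  unpaired triangles of a row need not lie above the next row.\<close>

theorem tiling_sum_eq_interlacing_sum:
  assumes "\<And>i. Suc i < k \<Longrightarrow> x i < x (Suc i)" "\<And>i. Suc i < k \<Longrightarrow> m i < m (Suc i)"
    and "\<And>c j. j < k \<Longrightarrow> c < x j \<Longrightarrow> w {up c j, down c j} = real (x j) - real c"
  shows "(\<Sum>T\<in>tilings (region x k m). \<Prod>r\<in>{r\<in>T. nw_se r}. w r) = interlacing_sum x k m"
  using assms
proof (induction k arbitrary: m)
  case 0
  have "tilings (region x 0 m) = {{}}"
    by (auto simp: tilings_def region_def partition_on_def)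
  then show ?case by simp
next
  case (Suc k)
  show ?case
  proof (cases "m k \<le> x k")
    case True
    interpret tiling_row x k m using Suc.prems True by unfold_locales auto
    have "(\<Sum>T\<in>tilings (region x k n). \<Prod>r\<in>{r\<in>T. nw_se r}. w r) = interlacing_sum x k n"
      if "n \<in> interlacing k m" for n
      using interlacing_strict[OF that] Suc.prems by (intro Suc.IH) auto
    then show ?thesis using Suc.prems(3) by (subst tiling_sum_step) auto
  next
    case False
    then show ?thesis using interlacing_sum_vanish[of "Suc k" x k m] Suc.prems tilings_empty_peak[of x k m] by auto
  qed
qed

section \<open>The region of a pair of partitions and its weights\<close>

text \<open>The beta numbers of a partition with at most \<open>d\<close> parts, in increasing order.\<close>

definition beta :: "nat list \<Rightarrow> nat \<Rightarrow> nat \<Rightarrow> nat" where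
  "beta lam d r = nth_part lam (d - r) + r"

lemma beta_strict: "is_partition lam \<Longrightarrow> Suc r < d \<Longrightarrow> beta lam d r < beta lam d (Suc r)"
  using nth_part_antimono[of lam "d - Suc r" "d - r"] by (fastforce simp: beta_def)

lemma nabla_eq_region:
  "nabla lam mu = region (beta lam (length lam)) (length lam) (beta mu (length lam))"
  (is "_ = region ?x ?d ?m")
proof -
  note beta_def [simp]
  have "Up (a, b) \<in> nabla lam mu \<longleftrightarrow> Up (a, b) \<in> region ?x ?d ?m" for a b
  proof (cases "0 \<le> b \<and> - b \<le> a")
    case True
    define c j where "c = nat (a + b)" and "j = nat b"
    have cj: "a = int c - int j" "b = int j" using True by (auto simp: c_def j_def)
    have "(\<exists>i\<in>{1..?d}. int c - int ?d = int (nth_part mu i) - int i) \<longleftrightarrow> c \<in> ?m ` {..<?d}"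
    proof
      assume "\<exists>i\<in>{1..?d}. int c - int ?d = int (nth_part mu i) - int i"
      then obtain i where "i \<in> {1..?d}" "int c - int ?d = int (nth_part mu i) - int i" by blast
      then show "c \<in> ?m ` {..<?d}" by (intro image_eqI[of _ _ "?d - i"]) auto
    next
      assume "c \<in> ?m ` {..<?d}"
      then obtain r where "r < ?d" "c = ?m r" by auto
      then show "\<exists>i\<in>{1..?d}. int c - int ?d = int (nth_part mu i) - int i"
        by (intro bexI[of _ "?d - r"]) auto
    qed
    then have "Up (int c - int j, int j) \<in> nabla lam mu \<longleftrightarrow> up c j \<in> region ?x ?d ?m"
      unfolding Up_in_nabla region_iff by auto
    then show ?thesis by (simp add: cj up_def)
  next
    case False
    have "Up (a, b) \<notin> region ?x ?d ?m"
    proof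
      assume "Up (a, b) \<in> region ?x ?d ?m"
      then show False by (rule region_cases) (use False in \<open>auto simp: up_def down_def\<close>)
    qed
    then show ?thesis using False by (auto simp: Up_in_nabla)
  qed
  moreover have "Down (a, b) \<in> nabla lam mu \<longleftrightarrow> Down (a, b) \<in> region ?x ?d ?m" for a b
  proof (cases "0 \<le> b \<and> - b \<le> a")
    case True
    define c j where "c = nat (a + b)" and "j = nat b"
    have cj: "a = int c - int j" "b = int j" using True by (auto simp: c_def j_def)
    have "Down (int c - int j, int j) \<in> nabla lam mu \<longleftrightarrow> down c j \<in> region ?x ?d ?m"
      unfolding Down_in_nabla region_iff by auto
    then show ?thesis by (simp add: cj down_def)
  next
    case False
    have "Down (a, b) \<notin> region ?x ?d ?m"
    proof
      assume "Down (a, b) \<in> region ?x ?d ?m"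
      then show False by (rule region_cases) (use False in \<open>auto simp: up_def down_def\<close>)
    qed
    then show ?thesis using False by (auto simp: Down_in_nabla)
  qed
  ultimately have "t \<in> nabla lam mu \<longleftrightarrow> t \<in> region ?x ?d ?m" for t
    by (cases t) (simp_all only: split_paired_all)
  then show ?thesis by blast
qed

text \<open>The coordinates of a point of the plane with respect to the directions \<open>E\<close> and \<open>NE\<close>.\<close>

definition lattice_x :: "complex \<Rightarrow> real" where "lattice_x z = Re z - Im z / sqrt 3"
definition lattice_y :: "complex \<Rightarrow> real" where "lattice_y z = 2 * Im z / sqrt 3"

lemma lattice_plane_point [simp]:
  "lattice_x (plane_point p) = of_int (fst p)" "lattice_y (plane_point p) = of_int (snd p)"
  by (simp_all add: lattice_x_def lattice_y_def plane_point_def cos_60 sin_60)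

text \<open>A triangle lies in such a set as soon as its vertices do.\<close>

lemma convex_lattice_strip:
  "convex {z. l \<le> lattice_y z \<and> lattice_y z \<le> h \<and> lattice_x z \<le> r}"
proof -
  have "linear lattice_x" "linear lattice_y"
    by (auto intro!: linearI simp: lattice_x_def lattice_y_def field_simps)
  then have "convex (lattice_x -` {..r} \<inter> lattice_y -` {l..h})"
    by (intro convex_Int convex_linear_vimage) auto
  moreover have "lattice_x -` {..r} \<inter> lattice_y -` {l..h} = {z. l \<le> lattice_y z \<and> lattice_y z \<le> h \<and> lattice_x z \<le> r}"
    by auto
  ultimately show ?thesis by simp
qed

lemma triangle_in_strip:
  assumes "\<And>p. p \<in> verts t \<Longrightarrow> l \<le> real_of_int (snd p) \<and> real_of_int (snd p) \<le> h \<and> real_of_int (fst p) \<le> r"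
    and "z \<in> convex hull (plane_point ` verts t)"
  shows "l \<le> lattice_y z" "lattice_y z \<le> h" "lattice_x z \<le> r"
proof -
  have "convex hull (plane_point ` verts t) \<subseteq> {z. l \<le> lattice_y z \<and> lattice_y z \<le> h \<and> lattice_x z \<le> r}"
    by (rule hull_minimal) (use assms(1) convex_lattice_strip in auto)
  then show "l \<le> lattice_y z" "lattice_y z \<le> h" "lattice_x z \<le> r" using assms(2) by auto
qed

text \<open>At the mid-height of a row only triangles of that row are met, and their vertices do not lie beyond the \<open>NE\<close> step that
  ends the row.\<close>

lemma lattice_x_bound:
  assumes z: "z \<in> plane_region (nabla lam mu)" and j: "j < length lam"
    and y: "lattice_y z = real j + 1 / 2"
  shows "lattice_x z \<le> real (nth_part lam (length lam - j))"
proof -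
  obtain t where t: "t \<in> nabla lam mu" "z \<in> convex hull (plane_point ` verts t)"
    using z by (auto simp: plane_region_def)
  then consider i where "i < length lam" "t \<in> region_row lam i" | "t \<in> peaks lam mu"
    by (auto simp: nabla_def)
  then show ?thesis
  proof cases
    case (1 i)
    have s: "real i \<le> real_of_int (snd p) \<and> real_of_int (snd p) \<le> real i + 1 \<and>
        real_of_int (fst p) \<le> real (nth_part lam (length lam - i))" if "p \<in> verts t" for p
    proof -
      have "int i \<le> snd p" "snd p \<le> int i + 1" "fst p \<le> int (nth_part lam (length lam - i))"
        using 1(2) that by (auto simp: region_row_def)
      then show ?thesis by linarith
    qed
    note b = triangle_in_strip[OF s t(2)]
    have "i = j" using b(1,2) y by linarith
    then show ?thesis using b(3) by simp
  next
    case 2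
    then obtain a where a: "t = Up (a, int (length lam))" by (auto simp: peaks_def)
    have s: "real (length lam) \<le> real_of_int (snd p) \<and> real_of_int (snd p) \<le> real (length lam) + 1 \<and>
        real_of_int (fst p) \<le> real_of_int (a + 1)" if "p \<in> verts t" for p
      using that a by auto
    have "real (length lam) \<le> lattice_y z" using triangle_in_strip[OF s t(2)] by simp
    then show ?thesis using y j by linarith
  qed
qed

text \<open>The center of the lozenge has the lattice coordinates \<open>c - j\<close> and \<open>j + 1/2\<close>. The rightmost point at its height is
  the midpoint of the \<open>NE\<close> step on the right of row \<open>j\<close>, whose first coordinate is \<open>\<lambda>\<^bsub>d-j\<^esub>\<close>.\<close>

lemma weight_nw_se:
  assumes j: "j < length lam" and c: "c < beta lam (length lam) j"
  shows "weight lam mu {up c j, down c j} = real (beta lam (length lam) j) - real c"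
proof -
  define L where "L = nth_part lam (length lam - j)"
  define a where "a = int c - int j"
  define r where "r = {up c j, down c j}"
  define P where "P = plane_region (nabla lam mu)"
  have r: "r = {Up (a, int j), Down (a, int j)}" by (simp add: r_def a_def up_def down_def)
  have "lozenge_verts r = {(a, int j), (a + 1, int j), (a, int j + 1), (a - 1, int j + 1)}"
    by (auto simp: r lozenge_verts_def)
  then have cen: "center r = of_real (real_of_int a) + of_real (real j + 1 / 2) * cis (pi / 3)"
    by (simp add: center_def plane_point_def field_simps)
  define h where "h = Im (center r)"
  have h: "h = (real j + 1 / 2) * (sqrt 3 / 2)" by (simp add: h_def cen sin_60)
  have Re: "Re (center r) = real_of_int a + (real j + 1 / 2) / 2" by (simp add: cen cos_60)
  define e where "e = Complex (real L + (real j + 1 / 2) / 2) h"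
  have "Sup (Re ` {z \<in> P. Im z = h}) = Re e"
  proof (rule cSup_eq_maximum)
    have "Down (int L, int j) \<in> nabla lam mu" using j by (simp add: Down_in_nabla L_def)
    moreover have "e \<in> convex hull (plane_point ` verts (Down (int L, int j)))"
    proof -
      have "e = (1/2) *\<^sub>R plane_point (int L, int j) + (1/2) *\<^sub>R plane_point (int L, int j + 1)"
        by (simp add: e_def h complex_eq_iff plane_point_def cos_60 sin_60 field_simps)
      moreover have "plane_point (int L, int j) \<in> convex hull (plane_point ` verts (Down (int L, int j)))"
        "plane_point (int L, int j + 1) \<in> convex hull (plane_point ` verts (Down (int L, int j)))"
        by (auto intro!: hull_inc)
      ultimately show ?thesis
        using convexD[OF convex_convex_hull, of _ "plane_point ` verts (Down (int L, int j))" _ "1/2" "1/2"] by simp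
    qed
    ultimately have "e \<in> P" unfolding P_def plane_region_def by blast
    then show "Re e \<in> Re ` {z \<in> P. Im z = h}" by (intro imageI) (simp add: e_def)
    fix v assume "v \<in> Re ` {z \<in> P. Im z = h}"
    then obtain z where z: "z \<in> P" "Im z = h" "v = Re z" by auto
    have "lattice_y z = real j + 1 / 2" unfolding lattice_y_def z(2) h by simp
    then have "lattice_x z \<le> real L" using lattice_x_bound z(1) j unfolding P_def L_def by blast
    moreover have "h / sqrt 3 = (real j + 1 / 2) / 2" by (simp add: h)
    ultimately show "v \<le> Re e" using z by (simp add: e_def lattice_x_def)
  qed
  then have "rightmost P h = e" by (simp add: rightmost_def e_def)
  then have "weight lam mu r = dist (center r) e" by (simp add: weight_def P_def h_def)
  also have "\<dots> = cmod (of_real (real_of_int a - real L))"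
    unfolding dist_norm by (rule arg_cong[where f = cmod]) (simp add: complex_eq_iff Re e_def h_def)
  also have "\<dots> = \<bar>real_of_int a - real L\<bar>" by (rule norm_of_real)
  also have "\<dots> = real (L + j) - real c" using c unfolding beta_def L_def[symmetric] a_def by simp
  finally show ?thesis by (simp add: r_def L_def beta_def)
qed

section \<open>Standard fillings\<close>

text \<open>Standard tableaux on an arbitrary set of cells, so that a cell can be removed without leaving the class of
  shapes.\<close>

definition fillings :: "(nat \<times> nat) set \<Rightarrow> (nat \<times> nat \<Rightarrow> nat) set" where
  "fillings S = {T \<in> extensional S. bij_betw T S {1..card S} \<and>
     (\<forall>i j j'. (i, j) \<in> S \<and> (i, j') \<in> S \<and> j < j' \<longrightarrow> T (i, j) < T (i, j')) \<and>
     (\<forall>i i' j. (i, j) \<in> S \<and> (i', j) \<in> S \<and> i < i' \<longrightarrow> T (i, j) < T (i', j))}"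

definition precedes :: "nat \<times> nat \<Rightarrow> nat \<times> nat \<Rightarrow> bool" where
  "precedes u v \<longleftrightarrow> (fst u = fst v \<and> snd u < snd v) \<or> (snd u = snd v \<and> fst u < fst v)"

definition minimal_cells :: "(nat \<times> nat) set \<Rightarrow> (nat \<times> nat) set" where
  "minimal_cells S = {u \<in> S. \<forall>v\<in>S. \<not> precedes v u}"

lemma fillings_iff:
  "T \<in> fillings S \<longleftrightarrow> T \<in> extensional S \<and> bij_betw T S {1..card S} \<and>
     (\<forall>u\<in>S. \<forall>v\<in>S. precedes u v \<longrightarrow> T u < T v)"
proof -
  have "(\<forall>u\<in>S. \<forall>v\<in>S. precedes u v \<longrightarrow> T u < T v) \<longleftrightarrow>
     (\<forall>i j j'. (i, j) \<in> S \<and> (i, j') \<in> S \<and> j < j' \<longrightarrow> T (i, j) < T (i, j')) \<and>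
     (\<forall>i i' j. (i, j) \<in> S \<and> (i', j) \<in> S \<and> i < i' \<longrightarrow> T (i, j) < T (i', j))"
    unfolding precedes_def by fastforce
  then show ?thesis unfolding fillings_def by blast
qed

lemma finite_fillings:
  assumes "finite S" shows "finite (fillings S)"
proof -
  have "fillings S \<subseteq> Pi\<^sub>E S (\<lambda>_. {1..card S})"
    unfolding fillings_iff bij_betw_def PiE_iff subset_iff by blast
  then show ?thesis using assms by (auto intro: finite_subset finite_PiE)
qed

lemma fillings_empty: "fillings {} = {\<lambda>_. undefined}"
  by (auto simp: fillings_iff bij_betw_def)

text \<open>Deleting the entry 1 and lowering all other entries by one.\<close>

lemma card_fillings_min:
  assumes S: "finite S" and u: "u \<in> minimal_cells S"
  shows "card {T \<in> fillings S. T u = 1} = card (fillings (S - {u}))"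
proof (rule bij_betw_same_card)
  define A where "A = S - {u}"
  have uS: "u \<in> S" and umin: "\<And>v. v \<in> S \<Longrightarrow> \<not> precedes v u" using u by (auto simp: minimal_cells_def)
  have SA: "S = insert u A" "u \<notin> A" using uS by (auto simp: A_def)
  have finA: "finite A" using S by (simp add: A_def)
  have cS: "card S = Suc (card A)" using SA finA by simp
  define del where "del T = (\<lambda>v\<in>A. T v - 1)" for T :: "nat \<times> nat \<Rightarrow> nat"
  define ins where "ins T = (\<lambda>v\<in>S. if v = u then 1 else Suc (T v))" for T :: "nat \<times> nat \<Rightarrow> nat"
  have pos: "T v \<ge> 2" if "T \<in> fillings S" "T u = 1" "v \<in> A" for T v
  proof -
    have b: "bij_betw T S {1..card S}" using that by (simp add: fillings_iff)
    then have "T v \<in> {1..card S}" using that SA by (auto simp: bij_betw_def)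
    moreover have "T v \<noteq> T u"
      using inj_onD[OF bij_betw_imp_inj_on[OF b], of v u] that(3) SA by blast
    ultimately show ?thesis using that by auto
  qed
  show "bij_betw del {T \<in> fillings S. T u = 1} (fillings (S - {u}))"
    unfolding A_def[symmetric]
  proof (rule bij_betw_byWitness[where f' = ins])
    show "\<forall>T\<in>{T \<in> fillings S. T u = 1}. ins (del T) = T"
    proof (intro ballI ext)
      fix T v assume T: "T \<in> {T \<in> fillings S. T u = 1}"
      then have T: "T \<in> fillings S" "T u = 1" by auto
      then have ext: "T \<in> extensional S" by (simp add: fillings_iff)
      consider "v \<notin> S" | "v = u" | "v \<in> A" using SA by blast
      then show "ins (del T) v = T v"
      proof cases
        case 1
        then show ?thesis using extensional_arb[OF ext] by (simp add: ins_def)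
      next
        case 2
        then show ?thesis using T uS by (simp add: ins_def)
      next
        case 3
        then show ?thesis using pos[OF T 3] SA by (auto simp: ins_def del_def)
      qed
    qed
    show "\<forall>T\<in>fillings A. del (ins T) = T"
    proof (intro ballI ext)
      fix T v assume T: "T \<in> fillings A"
      then have "T \<in> extensional A" by (simp add: fillings_iff)
      then show "del (ins T) v = T v"
        using SA extensional_arb[of T A v] by (cases "v \<in> A") (auto simp: ins_def del_def)
    qed
    show "del ` {T \<in> fillings S. T u = 1} \<subseteq> fillings A"
    proof (rule image_subsetI)
      fix T assume "T \<in> {T \<in> fillings S. T u = 1}"
      then have T: "T \<in> fillings S" "T u = 1" by auto
      then have b: "inj_on T S" "T ` S = {1..card S}" and mono: "\<forall>u\<in>S. \<forall>v\<in>S. precedes u v \<longrightarrow> T u < T v"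
        by (auto simp: fillings_iff bij_betw_def)
      have inj: "inj_on (del T) A"
      proof (rule inj_onI)
        fix v w assume vw: "v \<in> A" "w \<in> A" "del T v = del T w"
        then have "T v = T w" using pos[OF T, of v] pos[OF T, of w] by (auto simp: del_def)
        then show "v = w" using b(1) vw SA by (auto dest: inj_onD)
      qed
      have "del T ` A \<subseteq> {1..card A}"
      proof (rule image_subsetI)
        fix v assume v: "v \<in> A"
        then have "T v \<in> {1..card S}" using b(2) SA by blast
        then show "del T v \<in> {1..card A}" using pos[OF T v] v cS by (auto simp: del_def)
      qed
      moreover have "card (del T ` A) = card {1..card A}" using inj by (simp add: card_image)
      ultimately have "del T ` A = {1..card A}" by (intro card_subset_eq) auto
      moreover have "del T v < del T w" if "v \<in> A" "w \<in> A" "precedes v w" for v w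
        using mono that pos[OF T that(1)] SA by (fastforce simp: del_def)
      moreover have "del T \<in> extensional A" by (simp add: del_def)
      ultimately show "del T \<in> fillings A" unfolding fillings_iff bij_betw_def using inj by blast
    qed
    show "ins ` fillings A \<subseteq> {T \<in> fillings S. T u = 1}"
    proof (rule image_subsetI)
      fix T assume T: "T \<in> fillings A"
      then have b: "inj_on T A" "T ` A = {1..card A}" and mono: "\<forall>u\<in>A. \<forall>v\<in>A. precedes u v \<longrightarrow> T u < T v"
        by (auto simp: fillings_iff bij_betw_def)
      have iv: "ins T v = Suc (T v)" "T v \<in> {1..card A}" if "v \<in> A" for v
        using that SA b(2) by (auto simp: ins_def)
      have iu: "ins T u = 1" using uS by (simp add: ins_def)
      have inj: "inj_on (ins T) S"
      proof (rule inj_onI)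
        fix v w assume "v \<in> S" "w \<in> S" "ins T v = ins T w"
        then show "v = w" using iv[of v] iv[of w] iu b(1) SA by (cases "v = u"; cases "w = u") (auto dest: inj_onD)
      qed
      have "ins T ` S \<subseteq> {1..card S}"
      proof (rule image_subsetI)
        fix v assume "v \<in> S"
        then show "ins T v \<in> {1..card S}" using iv[of v] iu cS SA by (cases "v = u") auto
      qed
      moreover have "card (ins T ` S) = card {1..card S}" using inj by (simp add: card_image)
      ultimately have "ins T ` S = {1..card S}" by (intro card_subset_eq) auto
      moreover have "ins T v < ins T w" if vw: "v \<in> S" "w \<in> S" "precedes v w" for v w
      proof -
        have "w \<noteq> u" using umin vw by blast
        then have w: "w \<in> A" using vw SA by simp
        show ?thesis
        proof (cases "v = u")
          case True
          then show ?thesis using iv[OF w] iu by simp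
        next
          case False
          then have "v \<in> A" using vw SA by simp
          then show ?thesis using iv[OF w] iv[of v] mono vw w by simp
        qed
      qed
      moreover have "ins T \<in> extensional S" by (simp add: ins_def)
      ultimately show "ins T \<in> {T \<in> fillings S. T u = 1}"
        unfolding fillings_iff bij_betw_def using inj iu by blast
    qed
  qed
qed

text \<open>The entry 1 stands in a minimal cell.\<close>

lemma card_fillings:
  assumes "finite S" "S \<noteq> {}"
  shows "card (fillings S) = (\<Sum>u\<in>minimal_cells S. card (fillings (S - {u})))"
proof -
  have fm: "finite (minimal_cells S)" using assms by (simp add: minimal_cells_def)
  have "fillings S = (\<Union>u\<in>minimal_cells S. {T \<in> fillings S. T u = 1})"
  proof (intro equalityI subsetI)
    fix T assume T: "T \<in> fillings S"
    then have b: "inj_on T S" "T ` S = {1..card S}" and mono: "\<forall>u\<in>S. \<forall>v\<in>S. precedes u v \<longrightarrow> T u < T v"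
      by (auto simp: fillings_iff bij_betw_def)
    have "card S \<ge> 1" using assms by (simp add: Suc_leI card_gt_0_iff)
    then have "1 \<in> T ` S" using b by simp
    then obtain u where u: "u \<in> S" "T u = 1" by auto
    have "\<not> precedes v u" if "v \<in> S" for v
    proof
      assume "precedes v u"
      then have "T v < 1" using mono that u by metis
      moreover have "T v \<in> {1..card S}" using b that by blast
      ultimately show False by simp
    qed
    then show "T \<in> (\<Union>u\<in>minimal_cells S. {T \<in> fillings S. T u = 1})"
      using T u unfolding minimal_cells_def by blast
  qed auto
  then have "card (fillings S) = card (\<Union>u\<in>minimal_cells S. {T \<in> fillings S. T u = 1})" by simp
  also have "\<dots> = (\<Sum>u\<in>minimal_cells S. card {T \<in> fillings S. T u = 1})"
  proof (rule card_UN_disjoint[OF fm])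
    show "\<forall>u\<in>minimal_cells S. finite {T \<in> fillings S. T u = 1}" using finite_fillings assms by auto
    have "u = v" if "T \<in> fillings S" "T u = 1" "T v = 1" "u \<in> S" "v \<in> S" for T u v
    proof -
      have "inj_on T S" using that by (simp add: fillings_iff bij_betw_def)
      then show ?thesis using that by (metis inj_onD)
    qed
    then show "\<forall>u\<in>minimal_cells S. \<forall>v\<in>minimal_cells S. u \<noteq> v \<longrightarrow>
        {T \<in> fillings S. T u = 1} \<inter> {T \<in> fillings S. T v = 1} = {}"
      unfolding minimal_cells_def by blast
  qed
  also have "\<dots> = (\<Sum>u\<in>minimal_cells S. card (fillings (S - {u})))"
    using card_fillings_min assms by (intro sum.cong) auto
  finally show ?thesis .
qed

text \<open>The skew shape given by two sequences of beta numbers: since entry \<open>r\<close> of a sequence is the part number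
  \<open>d - r\<close> increased by \<open>r\<close>, the columns of row \<open>d - r\<close> are shifted by \<open>r\<close>.\<close>

definition cells :: "nat \<Rightarrow> (nat \<Rightarrow> nat) \<Rightarrow> (nat \<Rightarrow> nat) \<Rightarrow> (nat \<times> nat) set" where
  "cells d x m = {(i, j). 1 \<le> i \<and> i \<le> d \<and> m (d - i) < j + (d - i) \<and> j + (d - i) \<le> x (d - i)}"

text \<open>The leftmost cell of the skew shape in row \<open>d - r\<close>, if that row is nonempty.\<close>

definition addable_cell :: "nat \<Rightarrow> (nat \<Rightarrow> nat) \<Rightarrow> nat \<Rightarrow> nat \<times> nat" where
  "addable_cell d m r = (d - r, Suc (m r) - r)"

lemma cells_finite: "finite (cells d x m)"
proof -
  have "cells d x m \<subseteq> (SIGMA i:{1..d}. {..x (d - i)})" by (auto simp: cells_def)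
  then show ?thesis by (rule finite_subset) auto
qed

lemma card_cells:
  assumes "\<And>r. r < d \<Longrightarrow> r \<le> m r"
  shows "card (cells d x m) = (\<Sum>r<d. x r - m r)"
proof -
  have "cells d x m = (SIGMA i:{1..d}. {m (d - i) + 1 - (d - i)..<x (d - i) + 1 - (d - i)})"
    using assms by (force simp: cells_def)
  then have "card (cells d x m) = (\<Sum>i\<in>{1..d}. x (d - i) + 1 - (d - i) - (m (d - i) + 1 - (d - i)))"
    by simp
  also have "\<dots> = (\<Sum>i\<in>{1..d}. x (d - i) - m (d - i))"
  proof (rule sum.cong)
    fix i assume "i \<in> {1..d}"
    then show "x (d - i) + 1 - (d - i) - (m (d - i) + 1 - (d - i)) = x (d - i) - m (d - i)"
      using assms[of "d - i"] by auto
  qed simp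
  also have "\<dots> = (\<Sum>r<d. x r - m r)"
    by (rule sum.reindex_bij_witness[of _ "\<lambda>r. d - r" "\<lambda>i. d - i"]) auto
  finally show ?thesis .
qed

lemma shift_le:
  fixes m :: "nat \<Rightarrow> nat"
  assumes "\<And>i. Suc i < d \<Longrightarrow> m i < m (Suc i)" "i \<le> j" "j < d"
  shows "m i + (j - i) \<le> m j"
  using assms(2,3)
proof (induction j)
  case (Suc j)
  show ?case
  proof (cases "i = Suc j")
    case False
    then have "m i + (j - i) \<le> m j" "m j < m (Suc j)" using Suc assms(1)[of j] by auto
    then show ?thesis using False Suc.prems by auto
  qed simp
qed simp

text \<open>The first cell of a row is minimal unless the cell above it belongs to the skew shape, which means that the two
  corresponding entries of \<open>m\<close> differ by one only.\<close>

lemma minimal_cells_cells: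
  assumes m: "\<And>i. Suc i < d \<Longrightarrow> m i < m (Suc i)" and m0: "\<And>r. r < d \<Longrightarrow> r \<le> m r"
    and x: "\<And>i. Suc i < d \<Longrightarrow> x i < x (Suc i)"
  shows "minimal_cells (cells d x m) =
     addable_cell d m ` {r. r < d \<and> m r < x r \<and> (Suc r < d \<longrightarrow> Suc (m r) < m (Suc r))}"
proof (intro set_eqI iffI)
  fix u assume u: "u \<in> minimal_cells (cells d x m)"
  obtain i j where ij: "u = (i, j)" by (cases u)
  define r where "r = d - i"
  have uc: "(i, j) \<in> cells d x m" using u ij by (simp add: minimal_cells_def)
  then have c: "r < d" "i = d - r" "m r < j + r" "j + r \<le> x r" by (auto simp: cells_def r_def)
  have j: "j = Suc (m r) - r"
  proof (rule ccontr)
    assume "j \<noteq> Suc (m r) - r"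
    then have "(i, Suc (m r) - r) \<in> cells d x m" "Suc (m r) - r < j"
      using c m0[OF c(1)] by (auto simp: cells_def)
    then show False using u ij by (force simp: minimal_cells_def precedes_def)
  qed
  have "Suc (m r) < m (Suc r)" if "Suc r < d"
  proof (rule ccontr)
    assume "\<not> ?thesis"
    then have e: "m (Suc r) = Suc (m r)" using m[OF that] by simp
    have "d - (i - 1) = Suc r" using c that by auto
    then have "(i - 1, j) \<in> cells d x m"
      using c e that j m0[OF c(1)] x[OF that] by (auto simp: cells_def)
    then show False using u ij c that by (fastforce simp: minimal_cells_def precedes_def)
  qed
  then show "u \<in> addable_cell d m ` {r. r < d \<and> m r < x r \<and> (Suc r < d \<longrightarrow> Suc (m r) < m (Suc r))}"
    using c j ij by (auto simp: addable_cell_def)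
next
  fix u assume "u \<in> addable_cell d m ` {r. r < d \<and> m r < x r \<and> (Suc r < d \<longrightarrow> Suc (m r) < m (Suc r))}"
  then obtain r where r: "u = addable_cell d m r" "r < d" "m r < x r" "Suc r < d \<Longrightarrow> Suc (m r) < m (Suc r)" by auto
  have uc: "u \<in> cells d x m" using r m0[of r] by (auto simp: addable_cell_def cells_def)
  have "\<not> precedes v u" if v: "v \<in> cells d x m" for v
  proof
    assume p: "precedes v u"
    obtain i j where ij: "v = (i, j)" by (cases v)
    define s where "s = d - i"
    have c: "s < d" "i = d - s" "m s < j + s" using v ij by (auto simp: cells_def s_def)
    from p consider "s = r" "j + r < Suc (m r)" | "j = Suc (m r) - r" "r < s"
      using c r(2) by (auto simp: precedes_def ij r(1) addable_cell_def)
    then show False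
    proof cases
      case 1
      then show ?thesis using c by simp
    next
      case 2
      then have "Suc (m r) < m (Suc r)" using r(4) c by simp
      moreover have "m (Suc r) + (s - Suc r) \<le> m s" using shift_le[of d m "Suc r" s] m 2 c by simp
      ultimately show ?thesis using 2 c m0[OF r(2)] by linarith
    qed
  qed
  then show "u \<in> minimal_cells (cells d x m)" using uc by (simp add: minimal_cells_def)
qed

lemma cells_remove_addable:
  assumes m0: "\<And>r. r < d \<Longrightarrow> r \<le> m r" and r: "r < d"
  shows "cells d x m - {addable_cell d m r} = cells d x (incr m r)"
proof -
  have "(i, j) \<in> cells d x m - {addable_cell d m r} \<longleftrightarrow> (i, j) \<in> cells d x (incr m r)" for i j
  proof (cases "d - i = r")
    case True
    define M where "M = m r"
    have "r \<le> M" using m0[OF r] by (simp add: M_def)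
    moreover have "(i, j) \<in> cells d x m \<longleftrightarrow> 1 \<le> i \<and> i \<le> d \<and> M < j + r \<and> j + r \<le> x r"
      "(i, j) \<in> cells d x (incr m r) \<longleftrightarrow> 1 \<le> i \<and> i \<le> d \<and> Suc M < j + r \<and> j + r \<le> x r"
      "i \<le> d \<Longrightarrow> (i, j) = addable_cell d m r \<longleftrightarrow> j = Suc M - r"
      using True by (auto simp: cells_def addable_cell_def M_def)
    ultimately show ?thesis by auto
  next
    case False
    then show ?thesis using r by (auto simp: cells_def addable_cell_def)
  qed
  then show ?thesis by (metis subset_antisym subrelI)
qed

text \<open>Induction on the number of cells. Removing a minimal cell raises one entry of \<open>m\<close>. The entries that do not
  belong to a minimal cell contribute nothing to the Pieri rule, since raising them repeats an entry of \<open>m\<close> or exceeds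
  \<open>x\<close>.\<close>

theorem card_fillings_cells:
  assumes m: "\<And>i. Suc i < d \<Longrightarrow> m i < m (Suc i)" and m0: "\<And>r. r < d \<Longrightarrow> r \<le> m r"
    and x: "\<And>i. Suc i < d \<Longrightarrow> x i < x (Suc i)" and mx: "\<And>r. r < d \<Longrightarrow> m r \<le> x r"
  shows "real (card (fillings (cells d x m))) * interlacing_sum x d x = fact (card (cells d x m)) * interlacing_sum x d m"
  using m m0 mx
proof (induction "card (cells d x m)" arbitrary: m)
  case 0
  have "(\<Sum>r<d. x r - m r) = 0" using 0 card_cells[of d m x] by simp
  then have "\<And>r. r < d \<Longrightarrow> x r = m r" using 0(4) by (simp add: le_antisym)
  then have "interlacing_sum x d x = interlacing_sum x d m" by (intro interlacing_sum_cong)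
  moreover have "cells d x m = {}" using 0(1) cells_finite by simp
  ultimately show ?case by (simp add: fillings_empty)
next
  case (Suc N)
  define R where "R = {r. r < d \<and> m r < x r \<and> (Suc r < d \<longrightarrow> Suc (m r) < m (Suc r))}"
  have inj: "inj_on (addable_cell d m) R" by (rule inj_onI) (auto simp: R_def addable_cell_def)
  have IH: "real (card (fillings (cells d x (incr m r)))) * interlacing_sum x d x = fact N * interlacing_sum x d (incr m r)"
    if r: "r \<in> R" for r
  proof -
    have rd: "r < d" "m r < x r" "Suc r < d \<Longrightarrow> Suc (m r) < m (Suc r)" using r by (auto simp: R_def)
    have "addable_cell d m r \<in> minimal_cells (cells d x m)"
      using minimal_cells_cells[of d m x] Suc.prems x r by (auto simp: R_def)
    then have "addable_cell d m r \<in> cells d x m" by (simp add: minimal_cells_def)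
    then have N: "N = card (cells d x (incr m r))"
      using cells_remove_addable[of d m r x] Suc.prems(2) rd(1) Suc.hyps(2)
      by (metis cells_finite card_Diff_singleton diff_Suc_1)
    have "real (card (fillings (cells d x (incr m r)))) * interlacing_sum x d x =
      fact (card (cells d x (incr m r))) * interlacing_sum x d (incr m r)"
    proof (rule Suc.hyps(1)[OF N])
      show "(incr m r) i < (incr m r) (Suc i)" if "Suc i < d" for i
        using Suc.prems(1)[OF that] rd(3) that by auto
      show "s \<le> (incr m r) s" if "s < d" for s
        using Suc.prems(2)[OF that] by auto
      show "(incr m r) s \<le> x s" if "s < d" for s
        using Suc.prems(3)[OF that] rd(2) by simp
    qed
    then show ?thesis using N by simp
  qed
  have zero: "interlacing_sum x d (incr m r) = 0" if "r < d" "r \<notin> R" for r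
  proof -
    have "x r \<le> m r \<or> (Suc r < d \<and> m (Suc r) \<le> Suc (m r))" using that by (auto simp: R_def)
    then consider "x r \<le> m r" | "Suc r < d" "m (Suc r) \<le> Suc (m r)" by blast
    then show ?thesis
    proof cases
      case 1
      then show ?thesis using interlacing_sum_vanish[of d x r "incr m r"] x that by simp
    next
      case 2
      then have "m (Suc r) = Suc (m r)" using Suc.prems(1) by (simp add: le_antisym Suc_leI)
      then show ?thesis using interlacing_sum_repeated[of r d "incr m r" x] 2 by simp
    qed
  qed
  have ne: "cells d x m \<noteq> {}" using Suc.hyps(2) by auto
  have "card (fillings (cells d x m)) = (\<Sum>u\<in>addable_cell d m ` R. card (fillings (cells d x m - {u})))"
    unfolding R_def using minimal_cells_cells[of d m x] Suc.prems x card_fillings[OF cells_finite ne] by simp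
  also have "\<dots> = (\<Sum>r\<in>R. card (fillings (cells d x m - {addable_cell d m r})))"
    by (subst sum.reindex[OF inj]) simp
  also have "\<dots> = (\<Sum>r\<in>R. card (fillings (cells d x (incr m r))))"
    using Suc.prems(2) by (intro sum.cong refl) (simp add: cells_remove_addable R_def)
  finally have "real (card (fillings (cells d x m))) * interlacing_sum x d x =
      (\<Sum>r\<in>R. real (card (fillings (cells d x (incr m r)))) * interlacing_sum x d x)"
    by (simp add: sum_distrib_right)
  also have "\<dots> = fact N * (\<Sum>r\<in>R. interlacing_sum x d (incr m r))"
    by (simp add: IH sum_distrib_left)
  also have "(\<Sum>r\<in>R. interlacing_sum x d (incr m r)) = (\<Sum>r<d. interlacing_sum x d (incr m r))"
    using zero by (intro sum.mono_neutral_left) (auto simp: R_def)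
  also have "\<dots> = ((\<Sum>i<d. real (x i)) - (\<Sum>i<d. real (m i))) * interlacing_sum x d m"
    by (rule interlacing_sum_recurrence) (rule Suc.prems(1))
  also have "(\<Sum>i<d. real (x i)) - (\<Sum>i<d. real (m i)) = real (Suc N)"
  proof -
    have "real (\<Sum>i<d. x i - m i) = (\<Sum>i<d. real (x i) - real (m i))"
      using Suc.prems(3) by (simp add: of_nat_diff)
    then show ?thesis using card_cells[of d m x] Suc.prems(2) Suc.hyps(2) by (simp add: sum_subtractf)
  qed
  finally show ?case unfolding Suc.hyps(2)[symmetric] by (simp add: mult_ac)
qed

section \<open>Hook lengths\<close>

text \<open>For \<open>m = x\<close>, any sequence other than the lowest one has an entry that exceeds the corresponding entry of
  \<open>x\<close> and contributes nothing. For the lowest one, the gaps consist of all numbers below \<open>x\<^sub>k\<close> that are not entries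
  of \<open>x\<close>.\<close>

lemma interlacing_sum_diagonal_step:
  assumes x: "\<And>i. i < k \<Longrightarrow> x i < x (Suc i)"
  shows "interlacing_sum x (Suc k) x = (\<Prod>c\<in>{..<x k} - x ` {..<k}. real (x k) - real c) * interlacing_sum x k x"
proof -
  interpret tiling_row x k x using x by unfold_locales auto
  define n where "n = restrict x {..<k}"
  have nI: "n \<in> interlacing k x" using x by (auto simp: n_def interlacing_def)
  have zero: "interlacing_sum x k n' = 0" if n': "n' \<in> interlacing k x" "n' \<noteq> n" for n'
  proof -
    have "\<exists>i<k. n' i \<noteq> x i"
    proof (rule ccontr)
      assume "\<not> ?thesis"
      then have "n' i = n i" if "i \<in> {..<k}" for i using that by (simp add: n_def)
      then have "n' = n" using n'(1) nI unfolding interlacing_def by (intro PiE_ext)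
      then show False using n'(2) by simp
    qed
    then obtain i where i: "i < k" "n' i \<noteq> x i" by blast
    then have "x i < n' i" using leftover_bounds(1)[OF n'(1) i(1)] by simp
    then show ?thesis using interlacing_sum_vanish[of k x i n'] x i by simp
  qed
  have "ne_slots n = {}"
  proof (rule equals0I)
    fix c assume "c \<in> ne_slots n"
    then show False by (cases rule: ne_slot_cases[OF nI]) (auto simp: n_def)
  qed
  then have sub: "{..<x k} - n ` {..<k} \<subseteq> nw_slots k x n" by (auto simp: ne_slots_def)
  have "nw_slots k x n \<inter> n ` {..<k} = {}"
    using m_notin_nw_slots[OF nI] by (auto simp: n_def)
  then have "nw_slots k x n = {..<x k} - n ` {..<k}" using sub nw_slots_bound[OF nI] by blast
  also have "n ` {..<k} = x ` {..<k}" by (auto simp: n_def)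
  finally have w: "row_weight (x k) k x n = (\<Prod>c\<in>{..<x k} - x ` {..<k}. real (x k) - real c)"
    by (simp add: row_weight_nw_slots[OF nI])
  have "interlacing_sum x (Suc k) x = (\<Sum>n'\<in>interlacing k x. if n' = n then row_weight (x k) k x n * interlacing_sum x k n else 0)"
    unfolding interlacing_sum.simps using zero by (intro sum.cong) auto
  also have "\<dots> = row_weight (x k) k x n * interlacing_sum x k n" using nI by simp
  also have "interlacing_sum x k n = interlacing_sum x k x" by (rule interlacing_sum_cong) (simp add: n_def)
  finally show ?thesis by (simp add: w)
qed

lemma interlacing_sum_diagonal:
  assumes "\<And>i. Suc i < d \<Longrightarrow> x i < x (Suc i)"
  shows "interlacing_sum x d x = (\<Prod>k<d. \<Prod>c\<in>{..<x k} - x ` {..<k}. real (x k) - real c)"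
  using assms
proof (induction d)
  case (Suc d)
  then have IH: "interlacing_sum x d x = (\<Prod>k<d. \<Prod>c\<in>{..<x k} - x ` {..<k}. real (x k) - real c)" by simp
  have "interlacing_sum x (Suc d) x = (\<Prod>c\<in>{..<x d} - x ` {..<d}. real (x d) - real c) * interlacing_sum x d x"
    using Suc.prems by (intro interlacing_sum_diagonal_step) simp
  then show ?case by (simp add: IH mult.commute del: interlacing_sum.simps)
qed simp

text \<open>For \<open>j = 1, 2, \<dots>\<close> these are the natural numbers that are not beta numbers of the partition, in increasing
  order: reading the boundary of the diagram from the bottom left corner and numbering its steps from 0, beta numbers
  mark the vertical steps, and the horizontal step in column \<open>j\<close> is preceded by the \<open>j - 1\<close> horizontal steps of
  the earlier columns and by the vertical steps of the rows shorter than \<open>j\<close>.\<close>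

definition vacant :: "nat list \<Rightarrow> nat \<Rightarrow> nat" where
  "vacant lam j = j - 1 + card {i \<in> {1..length lam}. nth_part lam i < j}"

text \<open>On the boundary of the diagram, the hook of a cell joins the horizontal step below the cell to the vertical step on
  its right, and its length is the difference of their numbers. In the calculation, the rows below row \<open>i\<close> are split
  according to whether they reach column \<open>j\<close>, that is, whether they belong to the leg.\<close>

lemma hook_vacant:
  assumes lam: "is_partition lam" and u: "(i, j) \<in> diagram lam"
  shows "hook_length lam (i, j) + vacant lam j = beta lam (length lam) (length lam - i)"
proof -
  define d where "d = length lam"
  define L where "L = nth_part lam"
  have anti: "L b \<le> L a" if "1 \<le> a" "a \<le> b" for a b
    using nth_part_antimono[OF lam that] by (simp add: L_def)
  have ij: "1 \<le> i" "i \<le> d" "1 \<le> j" "j \<le> L i" using u by (auto simp: diagram_def d_def L_def)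
  have "hook lam (i, j) = {i} \<times> {j..L i} \<union> {i' \<in> {Suc i..d}. j \<le> L i'} \<times> {j}"
    using ij by (auto simp: hook_def diagram_def d_def L_def)
  then have "hook_length lam (i, j) = card ({i} \<times> {j..L i} \<union> {i' \<in> {Suc i..d}. j \<le> L i'} \<times> {j})"
    by (simp add: hook_length_def)
  also have "\<dots> = (Suc (L i) - j) + card {i' \<in> {Suc i..d}. j \<le> L i'}"
    by (subst card_Un_disjoint) (auto simp: card_cartesian_product)
  finally have h: "hook_length lam (i, j) = (Suc (L i) - j) + card {i' \<in> {Suc i..d}. j \<le> L i'}" .
  have "i' \<in> {Suc i..d}" if "i' \<in> {1..d}" "L i' < j" for i'
    using anti[of i' i] ij that by (cases "i' \<le> i") auto
  then have e: "{i' \<in> {1..d}. L i' < j} = {i' \<in> {Suc i..d}. L i' < j}" by auto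
  have "{Suc i..d} = {i' \<in> {Suc i..d}. j \<le> L i'} \<union> {i' \<in> {Suc i..d}. L i' < j}" by auto
  then have "card {Suc i..d} = card ({i' \<in> {Suc i..d}. j \<le> L i'} \<union> {i' \<in> {Suc i..d}. L i' < j})"
    by (rule arg_cong)
  also have "\<dots> = card {i' \<in> {Suc i..d}. j \<le> L i'} + card {i' \<in> {Suc i..d}. L i' < j}"
    by (rule card_Un_disjoint) auto
  finally have "card {i' \<in> {Suc i..d}. j \<le> L i'} + card {i' \<in> {Suc i..d}. L i' < j} = card {Suc i..d}" ..
  then have "card {i' \<in> {Suc i..d}. j \<le> L i'} + card {i' \<in> {1..d}. L i' < j} = d - i"
    unfolding e by simp
  moreover have "beta lam d (d - i) = L i + (d - i)" using ij by (simp add: beta_def L_def)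
  ultimately show ?thesis
    using h ij unfolding vacant_def d_def[symmetric] L_def[symmetric] by simp
qed

lemma hook_length_pos:
  assumes "(i, j) \<in> diagram lam"
  shows "0 < hook_length lam (i, j)"
proof -
  have "hook lam (i, j) \<subseteq> (SIGMA i:{1..length lam}. {..nth_part lam i})"
    by (auto simp: hook_def diagram_def)
  then have "finite (hook lam (i, j))" by (rule finite_subset) auto
  moreover have "(i, j) \<in> hook lam (i, j)" using assms by (simp add: hook_def)
  ultimately show ?thesis unfolding hook_length_def card_gt_0_iff by blast
qed

text \<open>If row \<open>d - l\<close> reaches column \<open>j\<close>, at most the \<open>l\<close> rows below it are shorter than \<open>j\<close>, and the vacant number is
  too small. Otherwise at least \<open>l + 1\<close> rows are, and it is too large.\<close>

lemma vacant_not_beta: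
  assumes lam: "is_partition lam" and l: "l < length lam" and j: "1 \<le> j"
  shows "vacant lam j \<noteq> beta lam (length lam) l"
proof -
  define d where "d = length lam"
  define L where "L = nth_part lam"
  define S where "S = {i \<in> {1..d}. L i < j}"
  have anti: "L b \<le> L a" if "1 \<le> a" "a \<le> b" for a b
    using nth_part_antimono[OF lam that] by (simp add: L_def)
  have ld: "l < d" using l by (simp add: d_def)
  have v: "vacant lam j = j - 1 + card S" by (simp add: vacant_def S_def d_def L_def)
  have b: "beta lam d l = L (d - l) + l" by (simp add: beta_def L_def)
  show ?thesis
  proof (cases "j \<le> L (d - l)")
    case True
    have "i \<in> {Suc (d - l)..d}" if "i \<in> S" for i
      using anti[of i "d - l"] True that ld by (cases "i \<le> d - l") (auto simp: S_def)
    then have "card S \<le> card {Suc (d - l)..d}" by (intro card_mono) auto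
    then have "card S \<le> l" using ld by simp
    then show ?thesis using v b True j unfolding d_def[symmetric] by simp
  next
    case False
    have "i \<in> S" if "i \<in> {d - l..d}" for i
    proof -
      have "1 \<le> d - l" "d - l \<le> i" "i \<le> d" using that ld by auto
      then show ?thesis using anti[of "d - l" i] False by (simp add: S_def)
    qed
    then have "card {d - l..d} \<le> card S" by (intro card_mono) (auto simp: S_def)
    then have "Suc l \<le> card S" using ld by simp
    then show ?thesis using v b False j unfolding d_def[symmetric] by simp
  qed
qed

lemma vacant_strict_mono:
  assumes "1 \<le> j" "j < j'"
  shows "vacant lam j < vacant lam j'"
proof -
  have "card {i \<in> {1..length lam}. nth_part lam i < j} \<le> card {i \<in> {1..length lam}. nth_part lam i < j'}"
    using assms by (intro card_mono) auto
  then show ?thesis using assms by (simp add: vacant_def)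
qed

text \<open>Both sets have as many elements as row \<open>i\<close> has cells.\<close>

lemma vacant_bij:
  assumes lam: "is_partition lam" and i: "1 \<le> i" "i \<le> length lam"
  defines "x \<equiv> beta lam (length lam)" and "k \<equiv> length lam - i"
  shows "bij_betw (vacant lam) {1..nth_part lam i} ({..<x k} - x ` {..<k})"
proof -
  have inj: "inj_on (vacant lam) {1..nth_part lam i}"
    using vacant_strict_mono by (intro linorder_inj_onI) (auto dest: less_imp_neq)
  have sub: "vacant lam ` {1..nth_part lam i} \<subseteq> {..<x k} - x ` {..<k}"
  proof (rule image_subsetI)
    fix j assume j: "j \<in> {1..nth_part lam i}"
    then have u: "(i, j) \<in> diagram lam" using i by (simp add: diagram_def)
    have "vacant lam j < x k" using hook_vacant[OF lam u] hook_length_pos[OF u] by (simp add: x_def k_def)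
    moreover have "vacant lam j \<noteq> x l" if "l < k" for l
      using vacant_not_beta[OF lam, of l j] that j by (simp add: x_def k_def)
    ultimately show "vacant lam j \<in> {..<x k} - x ` {..<k}" by auto
  qed
  have kd: "k < length lam" using i by (simp add: k_def)
  have lt: "x a < x b" if "a < b" "b \<le> k" for a b
    using less_upto[of k x a b] beta_strict[OF lam] that kd by (auto simp: x_def)
  have "inj_on x {..<k}"
  proof (rule inj_onI)
    fix a b assume "a \<in> {..<k}" "b \<in> {..<k}" "x a = x b"
    then show "a = b" using lt[of a b] lt[of b a] by (cases a b rule: linorder_cases) auto
  qed
  then have "card (x ` {..<k}) = k" by (simp add: card_image)
  moreover have "x ` {..<k} \<subseteq> {..<x k}" using lt by auto
  ultimately have "card ({..<x k} - x ` {..<k}) = x k - k" by (simp add: card_Diff_subset)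
  also have "\<dots> = nth_part lam i" using i by (simp add: x_def k_def beta_def)
  finally have "vacant lam ` {1..nth_part lam i} = {..<x k} - x ` {..<k}"
    using sub inj by (intro card_subset_eq) (auto simp: card_image)
  then show ?thesis using inj by (simp add: bij_betw_def)
qed

theorem prod_hook_lengths:
  assumes lam: "is_partition lam"
  defines "x \<equiv> beta lam (length lam)"
  shows "(\<Prod>u\<in>diagram lam. real (hook_length lam u)) = interlacing_sum x (length lam) x"
proof -
  define d where "d = length lam"
  have "diagram lam = (SIGMA i:{1..d}. {1..nth_part lam i})" by (auto simp: diagram_def d_def)
  then have "(\<Prod>u\<in>diagram lam. real (hook_length lam u)) =
      (\<Prod>i\<in>{1..d}. \<Prod>j\<in>{1..nth_part lam i}. real (hook_length lam (i, j)))"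
    by (simp add: prod.Sigma case_prod_unfold)
  also have "\<dots> = (\<Prod>i\<in>{1..d}. \<Prod>c\<in>{..<x (d - i)} - x ` {..<d - i}. real (x (d - i)) - real c)"
  proof (rule prod.cong[OF refl])
    fix i assume i: "i \<in> {1..d}"
    have "(\<Prod>j\<in>{1..nth_part lam i}. real (hook_length lam (i, j))) =
       (\<Prod>j\<in>{1..nth_part lam i}. real (x (d - i)) - real (vacant lam j))"
    proof (rule prod.cong[OF refl])
      fix j assume "j \<in> {1..nth_part lam i}"
      then have "(i, j) \<in> diagram lam" using i by (simp add: diagram_def d_def)
      from hook_vacant[OF lam this] show "real (hook_length lam (i, j)) = real (x (d - i)) - real (vacant lam j)"
        unfolding x_def d_def by linarith
    qed
    also have "\<dots> = (\<Prod>c\<in>{..<x (d - i)} - x ` {..<d - i}. real (x (d - i)) - real c)"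
      using vacant_bij[OF lam, of i] i unfolding x_def d_def by (intro prod.reindex_bij_betw) auto
    finally show "(\<Prod>j\<in>{1..nth_part lam i}. real (hook_length lam (i, j))) =
      (\<Prod>c\<in>{..<x (d - i)} - x ` {..<d - i}. real (x (d - i)) - real c)" .
  qed
  also have "\<dots> = (\<Prod>k<d. \<Prod>c\<in>{..<x k} - x ` {..<k}. real (x k) - real c)"
    by (rule prod.reindex_bij_witness[of _ "\<lambda>k. d - k" "\<lambda>i. d - i"]) auto
  also have "\<dots> = interlacing_sum x d x"
    using beta_strict[OF lam] by (intro interlacing_sum_diagonal[symmetric]) (simp add: x_def d_def)
  finally show ?thesis by (simp add: d_def)
qed

section \<open>The formula\<close>

lemma skew_eq_cells:
  "skew lam mu = cells (length lam) (beta lam (length lam)) (beta mu (length lam))"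
proof -
  have "(i, j) \<in> diagram nu \<longleftrightarrow> 1 \<le> i \<and> 1 \<le> j \<and> j \<le> nth_part nu i" for i j nu
    by (auto simp: diagram_def nth_part_def)
  moreover have "i \<le> length lam" if "1 \<le> j" "j \<le> nth_part lam i" for i j
    using that by (simp add: nth_part_def split: if_splits)
  ultimately have "(i, j) \<in> skew lam mu \<longleftrightarrow>
      1 \<le> i \<and> i \<le> length lam \<and> nth_part mu i < j \<and> j \<le> nth_part lam i" for i j
    unfolding skew_def Diff_iff by (metis One_nat_def Suc_leI not_le not_less0 neq0_conv order_trans)
  then show ?thesis
    by (auto simp: cells_def beta_def)
qed

theorem corollary5p5:
  fixes lam mu :: "nat list"
  assumes "is_partition lam" and "is_partition mu"
    and "diagram mu \<subseteq> diagram lam"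
  shows "real (card (SYT lam mu)) =
    fact (card (skew lam mu)) / (\<Prod>u\<in>diagram lam. real (hook_length lam u)) *
    (\<Sum>T\<in>tilings (nabla lam mu). \<Prod>r\<in>{r \<in> T. nw_se r}. weight lam mu r)"
proof -
  define d where "d = length lam"
  define x where "x = beta lam d"
  define m where "m = beta mu d"
  have x: "x i < x (Suc i)" and m: "m i < m (Suc i)" if "Suc i < d" for i
    using that assms(1,2) by (simp_all add: x_def m_def beta_strict)
  have mx: "m r \<le> x r" if "r < d" for r
    using nth_part_mono_diagram[OF assms(2,3), of "d - r"] that by (simp add: m_def x_def beta_def)
  have "(\<Sum>T\<in>tilings (nabla lam mu). \<Prod>r\<in>{r \<in> T. nw_se r}. weight lam mu r) = interlacing_sum x d m"
    unfolding nabla_eq_region d_def[symmetric] x_def[symmetric] m_def[symmetric]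
    by (rule tiling_sum_eq_interlacing_sum) (use x m weight_nw_se in \<open>auto simp: x_def d_def\<close>)
  moreover have "(\<Prod>u\<in>diagram lam. real (hook_length lam u)) = interlacing_sum x d x"
    using prod_hook_lengths[OF assms(1)] by (simp add: x_def d_def)
  moreover have "real (card (SYT lam mu)) * interlacing_sum x d x = fact (card (skew lam mu)) * interlacing_sum x d m"
  proof -
    have "SYT lam mu = fillings (skew lam mu)" by (simp add: SYT_def fillings_def)
    moreover have "skew lam mu = cells d x m" by (simp add: skew_eq_cells d_def x_def m_def)
    moreover have "r \<le> m r" for r by (simp add: m_def beta_def)
    ultimately show ?thesis using card_fillings_cells[of d m x] x m mx by simp
  qed
  moreover have "(\<Prod>u\<in>diagram lam. real (hook_length lam u)) > 0"
    using hook_length_pos by (intro prod_pos) auto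
  ultimately show ?thesis by (simp add: field_simps)
qed

end
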